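(* Let $G$ and $H$ be two finitely generated, left-orderable groups. Then no left-ordering on the free product $G*H$ is isolated. In particular, the space of left-orderings $\mathcal{LO}(G*H)$ is homeomorphic to the Cantor set.
   Context: A left-ordering on a group $\Gamma$ is a total order $\preceq$ on $\Gamma$ such that $\gamma_1\prec\gamma_2$ implies $\gamma_3\gamma_1\prec\gamma_3\gamma_2$ for all $\gamma_1,\gamma_2,\gamma_3\in\Gamma$. A group is left-orderable if it admits a left-ordering. $\mathcal{LO}(\Gamma)$ is the set of all left-orderings of $\Gamma$, with the subspace topology from $\{0,1\}^\Gamma$ (product topology), where $\preceq$ is identified with the characteristic function of its positive cone $\{\gamma\in\Gamma : \gamma\succ id\}$. A left-ordering $\preceq$ of $\Gamma$ is called isolated if there is a finite family $\{\gamma_1,\ldots,\gamma_n\}\subset\Gamma$ such that $\preceq$ is the only left-ordering of $\Gamma$ with $\gamma_i\succ id$ for $1\le i\le n$ (equivalently, $\preceq$ is an isolated point of $\mathcal{LO}(\Gamma)$).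
   Formalization: Both groups G and H are assumed nontrivial; without this the claim fails, e.g. for G trivial and H = Z, where G*H = Z has exactly two left-orderings, both isolated. *)

theory Defs
  imports "HOL-Analysis.Analysis" "HOL-Algebra.Algebra"
begin

text \<open>
  The free product of \<open>G\<close> and \<open>H\<close> is realised on reduced words: lists of non-identity letters,
  taken alternately from \<open>G\<close> (tagged \<open>Inl\<close>) and \<open>H\<close> (tagged \<open>Inr\<close>).
\<close>

definition reduced_words :: "('a, 'c) monoid_scheme \<Rightarrow> ('b, 'd) monoid_scheme \<Rightarrow> ('a + 'b) list set"
  where "reduced_words G H =
    {w. set w \<subseteq> Inl ` (carrier G - {\<one>\<^bsub>G\<^esub>}) \<union> Inr ` (carrier H - {\<one>\<^bsub>H\<^esub>}) \<and>
        successively (\<lambda>x y. isl x \<noteq> isl y) w}"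

text \<open>
  Multiplying a reduced word on the left by one letter: the letter is merged with the head of the
  word if both come from the same factor, and identity letters are dropped.
\<close>

fun letter_mult ::
    "('a, 'c) monoid_scheme \<Rightarrow> ('b, 'd) monoid_scheme \<Rightarrow> 'a + 'b \<Rightarrow> ('a + 'b) list \<Rightarrow> ('a + 'b) list"
  where
    "letter_mult G H (Inl g) (Inl g' # w) =
      (if g \<otimes>\<^bsub>G\<^esub> g' = \<one>\<^bsub>G\<^esub> then w else Inl (g \<otimes>\<^bsub>G\<^esub> g') # w)"
  | "letter_mult G H (Inr h) (Inr h' # w) =
      (if h \<otimes>\<^bsub>H\<^esub> h' = \<one>\<^bsub>H\<^esub> then w else Inr (h \<otimes>\<^bsub>H\<^esub> h') # w)"
  | "letter_mult G H (Inl g) w = (if g = \<one>\<^bsub>G\<^esub> then w else Inl g # w)"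
  | "letter_mult G H (Inr h) w = (if h = \<one>\<^bsub>H\<^esub> then w else Inr h # w)"

definition free_product ::
    "('a, 'c) monoid_scheme \<Rightarrow> ('b, 'd) monoid_scheme \<Rightarrow> ('a + 'b) list monoid"
  where "free_product G H =
    \<lparr>carrier = reduced_words G H, mult = (\<lambda>u v. foldr (letter_mult G H) u v), one = []\<rparr>"

lemma free_product_simps [simp]:
  "carrier (free_product G H) = reduced_words G H"
  "u \<otimes>\<^bsub>free_product G H\<^esub> v = foldr (letter_mult G H) u v"
  "\<one>\<^bsub>free_product G H\<^esub> = []"
  by (simp_all add: free_product_def)

lemma reduced_words_Nil [simp]: "[] \<in> reduced_words G H"
  by (simp add: reduced_words_def)

lemma reduced_words_ConsD: "x # w \<in> reduced_words G H \<Longrightarrow> w \<in> reduced_words G H"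
  by (cases w) (auto simp: reduced_words_def)

lemma reduced_words_Inl_Cons:
  "Inl g # w \<in> reduced_words G H \<longleftrightarrow>
    g \<in> carrier G \<and> g \<noteq> \<one>\<^bsub>G\<^esub> \<and> w \<in> reduced_words G H \<and> (\<forall>g' w'. w \<noteq> Inl g' # w')"
  by (cases w; cases "hd w") (auto simp: reduced_words_def)

lemma reduced_words_Inr_Cons:
  "Inr h # w \<in> reduced_words G H \<longleftrightarrow>
    h \<in> carrier H \<and> h \<noteq> \<one>\<^bsub>H\<^esub> \<and> w \<in> reduced_words G H \<and> (\<forall>h' w'. w \<noteq> Inr h' # w')"
  by (cases w; cases "hd w") (auto simp: reduced_words_def)

lemmas reduced_words_Cons = reduced_words_Inl_Cons reduced_words_Inr_Cons

lemma list_sum_cases: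
  obtains "w = []" | g w' where "w = Inl g # w'" | h w' where "w = Inr h # w'"
  by (cases w; cases "hd w") auto

locale free_product_groups = G: group G + H: group H
  for G :: "('a, 'c) monoid_scheme" and H :: "('b, 'd) monoid_scheme"
begin

abbreviation L where "L \<equiv> letter_mult G H"

abbreviation letters where "letters \<equiv> Inl ` carrier G \<union> Inr ` carrier H"

lemma letters_of_reduced: "w \<in> reduced_words G H \<Longrightarrow> set w \<subseteq> letters"
  by (auto simp: reduced_words_def)

lemma L_closed:
  assumes "x \<in> letters" "w \<in> reduced_words G H" shows "L x w \<in> reduced_words G H"
  using assms by (cases w rule: list_sum_cases) (auto simp: reduced_words_Cons)

lemma L_Inl_Inl:
  assumes "g \<in> carrier G" "k \<in> carrier G" "w \<in> reduced_words G H"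
  shows "L (Inl g) (L (Inl k) w) = L (Inl (g \<otimes>\<^bsub>G\<^esub> k)) w"
proof (cases w rule: list_sum_cases)
  case (2 a w')
  have a: "a \<in> carrier G" "a \<noteq> \<one>\<^bsub>G\<^esub>" and w': "\<forall>g' u. w' \<noteq> Inl g' # u"
    using assms(3) 2 by (auto simp: reduced_words_Cons)
  have L: "L (Inl x) w' = (if x = \<one>\<^bsub>G\<^esub> then w' else Inl x # w')" for x
    using w' by (cases w' rule: list_sum_cases) auto
  have "g \<otimes>\<^bsub>G\<^esub> k \<otimes>\<^bsub>G\<^esub> a = g \<otimes>\<^bsub>G\<^esub> (k \<otimes>\<^bsub>G\<^esub> a)"
    using assms a by (simp add: G.m_assoc)
  then show ?thesis using 2 L assms a by auto
qed (use assms in auto)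

lemma L_Inr_Inr:
  assumes "g \<in> carrier H" "k \<in> carrier H" "w \<in> reduced_words G H"
  shows "L (Inr g) (L (Inr k) w) = L (Inr (g \<otimes>\<^bsub>H\<^esub> k)) w"
proof (cases w rule: list_sum_cases)
  case (3 a w')
  have a: "a \<in> carrier H" "a \<noteq> \<one>\<^bsub>H\<^esub>" and w': "\<forall>g' u. w' \<noteq> Inr g' # u"
    using assms(3) 3 by (auto simp: reduced_words_Cons)
  have L: "L (Inr x) w' = (if x = \<one>\<^bsub>H\<^esub> then w' else Inr x # w')" for x
    using w' by (cases w' rule: list_sum_cases) auto
  have "g \<otimes>\<^bsub>H\<^esub> k \<otimes>\<^bsub>H\<^esub> a = g \<otimes>\<^bsub>H\<^esub> (k \<otimes>\<^bsub>H\<^esub> a)"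
    using assms a by (simp add: H.m_assoc)
  then show ?thesis using 3 L assms a by auto
qed (use assms in auto)

lemma L_one:
  assumes "w \<in> reduced_words G H"
  shows "L (Inl \<one>\<^bsub>G\<^esub>) w = w" "L (Inr \<one>\<^bsub>H\<^esub>) w = w"
  using assms by (cases w rule: list_sum_cases; auto simp: reduced_words_Cons)+

lemma foldr_L_closed:
  assumes "set u \<subseteq> letters" "w \<in> reduced_words G H"
  shows "foldr L u w \<in> reduced_words G H"
  using assms by (induction u) (auto intro: L_closed)

lemma foldr_L_Nil: "w \<in> reduced_words G H \<Longrightarrow> foldr L w [] = w"
proof (induction w)
  case (Cons x w)
  then have "foldr L w [] = w" using reduced_words_ConsD by blast
  then show ?case using Cons.prems
    by (cases x; cases w rule: list_sum_cases) (auto simp: reduced_words_Cons)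
qed simp

lemma foldr_L_L:
  assumes "x \<in> letters" "u \<in> reduced_words G H" "w \<in> reduced_words G H"
  shows "foldr L (L x u) w = L x (foldr L u w)"
proof (cases u rule: list_sum_cases)
  case 1
  then show ?thesis using assms L_one by (cases x) auto
next
  case (2 a u')
  have a: "a \<in> carrier G" and u': "foldr L u' w \<in> reduced_words G H"
    using assms 2 letters_of_reduced[OF assms(2)] by (auto intro: foldr_L_closed)
  show ?thesis
  proof (cases x)
    case (Inl g)
    then have "L x (L (Inl a) (foldr L u' w)) = L (Inl (g \<otimes>\<^bsub>G\<^esub> a)) (foldr L u' w)"
      using L_Inl_Inl a u' assms by auto
    then show ?thesis using 2 Inl L_one[OF u'] by auto
  qed (use 2 assms L_one[OF L_closed[OF _ u']] a in auto)
next
  case (3 a u')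
  have a: "a \<in> carrier H" and u': "foldr L u' w \<in> reduced_words G H"
    using assms 3 letters_of_reduced[OF assms(2)] by (auto intro: foldr_L_closed)
  show ?thesis
  proof (cases x)
    case (Inr g)
    then have "L x (L (Inr a) (foldr L u' w)) = L (Inr (g \<otimes>\<^bsub>H\<^esub> a)) (foldr L u' w)"
      using L_Inr_Inr a u' assms by auto
    then show ?thesis using 3 Inr L_one[OF u'] by auto
  qed (use 3 assms L_one[OF L_closed[OF _ u']] a in auto)
qed

lemma foldr_L_assoc:
  assumes "set u \<subseteq> letters" "v \<in> reduced_words G H" "w \<in> reduced_words G H"
  shows "foldr L (foldr L u v) w = foldr L u (foldr L v w)"
  using assms by (induction u) (auto simp: foldr_L_L foldr_L_closed)

lemma left_inverse_ex:
  assumes "set w \<subseteq> letters"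
  shows "\<exists>v \<in> reduced_words G H. \<forall>u \<in> reduced_words G H. foldr L v (foldr L w u) = u"
  using assms
proof (induction w)
  case Nil
  show ?case by (rule bexI[of _ "[]"]) auto
next
  case (Cons x w)
  then obtain v where v: "v \<in> reduced_words G H"
      "\<forall>u \<in> reduced_words G H. foldr L v (foldr L w u) = u" by auto
  define y where "y = (case x of Inl g \<Rightarrow> Inl (inv\<^bsub>G\<^esub> g) | Inr h \<Rightarrow> Inr (inv\<^bsub>H\<^esub> h))"
  have y: "y \<in> letters" using Cons.prems by (auto simp: y_def)
  have yx: "L y (L x u) = u" if "u \<in> reduced_words G H" for u
    using Cons.prems that L_one[OF that] by (auto simp: y_def L_Inl_Inl L_Inr_Inr)
  have y1: "L y [] \<in> reduced_words G H" using y by (intro L_closed) auto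
  let ?v = "foldr L v (L y [])"
  have "foldr L ?v (foldr L (x # w) u) = u" if u: "u \<in> reduced_words G H" for u
  proof -
    have wu: "foldr L w u \<in> reduced_words G H" using Cons.prems u by (auto intro: foldr_L_closed)
    then have xwu: "L x (foldr L w u) \<in> reduced_words G H"
      using Cons.prems by (intro L_closed) auto
    have "foldr L ?v (foldr L (x # w) u) = foldr L v (foldr L (L y []) (L x (foldr L w u)))"
      using foldr_L_assoc[OF letters_of_reduced[OF v(1)] y1 xwu] by simp
    also have "foldr L (L y []) (L x (foldr L w u)) = foldr L w u"
      using foldr_L_L[OF y _ xwu, of "[]"] yx[OF wu] by simp
    finally show ?thesis using v(2) u by simp
  qed
  moreover have "?v \<in> reduced_words G H"
    using v(1) y1 by (intro foldr_L_closed letters_of_reduced)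
  ultimately show ?case by blast
qed

lemma group_free_product: "group (free_product G H)"
proof (rule groupI)
  fix w assume "w \<in> carrier (free_product G H)"
  then have w: "w \<in> reduced_words G H" by simp
  obtain v where v: "v \<in> reduced_words G H"
      "\<forall>u \<in> reduced_words G H. foldr L v (foldr L w u) = u"
    using left_inverse_ex[OF letters_of_reduced[OF w]] by blast
  have "foldr L v w = []" using v(2)[rule_format, of "[]"] foldr_L_Nil[OF w] by simp
  then show "\<exists>v\<in>carrier (free_product G H). v \<otimes>\<^bsub>free_product G H\<^esub> w = \<one>\<^bsub>free_product G H\<^esub>"
    using v(1) by auto
qed (auto simp: foldr_L_assoc letters_of_reduced intro: foldr_L_closed[OF letters_of_reduced])

definition inl :: "'a \<Rightarrow> ('a + 'b) list" where "inl g = L (Inl g) []"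

definition inr :: "'b \<Rightarrow> ('a + 'b) list" where "inr h = L (Inr h) []"

lemma inl_hom: "inl \<in> hom G (free_product G H)"
proof (rule homI)
  fix g k assume gk: "g \<in> carrier G" "k \<in> carrier G"
  have k: "inl k \<in> reduced_words G H" unfolding inl_def using gk by (intro L_closed) auto
  show "inl (g \<otimes>\<^bsub>G\<^esub> k) = inl g \<otimes>\<^bsub>free_product G H\<^esub> inl k"
    using foldr_L_L[of "Inl g" "[]" "inl k"] L_Inl_Inl[of g k "[]"] gk k
    by (simp add: inl_def del: letter_mult.simps)
qed (auto simp: inl_def reduced_words_Cons)

lemma inr_hom: "inr \<in> hom H (free_product G H)"
proof (rule homI)
  fix g k assume gk: "g \<in> carrier H" "k \<in> carrier H"
  have k: "inr k \<in> reduced_words G H" unfolding inr_def using gk by (intro L_closed) auto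
  show "inr (g \<otimes>\<^bsub>H\<^esub> k) = inr g \<otimes>\<^bsub>free_product G H\<^esub> inr k"
    using foldr_L_L[of "Inr g" "[]" "inr k"] L_Inr_Inr[of g k "[]"] gk k
    by (simp add: inr_def del: letter_mult.simps)
qed (auto simp: inr_def reduced_words_Cons)

theorem free_product_universal:
  fixes K (structure)
  assumes K: "group K" and f: "f \<in> hom G K" and k: "k \<in> hom H K"
  shows "\<exists>\<phi> \<in> hom (free_product G H) K.
    (\<forall>g \<in> carrier G. \<phi> (inl g) = f g) \<and> (\<forall>h \<in> carrier H. \<phi> (inr h) = k h) \<and>
    (\<forall>\<psi> \<in> hom (free_product G H) K.
      (\<forall>g \<in> carrier G. \<psi> (inl g) = f g) \<and> (\<forall>h \<in> carrier H. \<psi> (inr h) = k h) \<longrightarrow>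
      (\<forall>w \<in> carrier (free_product G H). \<psi> w = \<phi> w))"
proof -
  interpret K: group K by fact
  interpret f: group_hom G K f using f by unfold_locales
  interpret k: group_hom H K k using k by unfold_locales
  interpret P: group "free_product G H" by (rule group_free_product)
  define e where "e = case_sum f k"
  define \<phi> where "\<phi> w = foldr (\<lambda>x z. e x \<otimes>\<^bsub>K\<^esub> z) w \<one>\<^bsub>K\<^esub>" for w
  have e: "e x \<in> carrier K" if "x \<in> letters" for x
    using that by (auto simp: e_def)
  have \<phi>_Cons: "\<phi> (x # w) = e x \<otimes>\<^bsub>K\<^esub> \<phi> w" and \<phi>_Nil: "\<phi> [] = \<one>\<^bsub>K\<^esub>" for x w
    by (simp_all add: \<phi>_def)
  have \<phi>_closed': "\<phi> w \<in> carrier K" if "set w \<subseteq> letters" for w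
    using that e by (induction w) (auto simp: \<phi>_Cons \<phi>_Nil)
  note \<phi>_closed = \<phi>_closed'[OF letters_of_reduced]
  have \<phi>_L: "\<phi> (L x w) = e x \<otimes>\<^bsub>K\<^esub> \<phi> w" if x: "x \<in> letters" and w: "w \<in> reduced_words G H" for x w
  proof -
    have w1: "\<phi> w \<in> carrier K" using \<phi>_closed w .
    consider "w = []" | a w' where "w = Inl a # w'" | a w' where "w = Inr a # w'"
      by (cases w rule: list_sum_cases)
    then show ?thesis
    proof cases
      case 1
      then show ?thesis using x by (auto simp: \<phi>_Cons \<phi>_Nil e_def)
    next
      case (2 a w')
      have *: "a \<in> carrier G" "\<phi> w' \<in> carrier K"
        using w 2 \<phi>_closed by (auto simp: reduced_words_Cons)
      have mm: "f (g \<otimes>\<^bsub>G\<^esub> a) \<otimes>\<^bsub>K\<^esub> \<phi> w' = f g \<otimes>\<^bsub>K\<^esub> (f a \<otimes>\<^bsub>K\<^esub> \<phi> w')" if "g \<in> carrier G" for g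
        using that * by (simp add: K.m_assoc)
      show ?thesis
      proof (cases x)
        case (Inl g)
        then have g: "g \<in> carrier G" using x by auto
        show ?thesis
        proof (cases "g \<otimes>\<^bsub>G\<^esub> a = \<one>\<^bsub>G\<^esub>")
          case True
          then have "\<phi> w' = f g \<otimes>\<^bsub>K\<^esub> (f a \<otimes>\<^bsub>K\<^esub> \<phi> w')" using mm[OF g] * by simp
          then show ?thesis using True 2 Inl by (simp add: \<phi>_Cons e_def)
        qed (use 2 Inl mm[OF g] in \<open>simp add: \<phi>_Cons e_def\<close>)
      next
        case (Inr h)
        then show ?thesis using 2 x w1 by (auto simp: \<phi>_Cons e_def)
      qed
    next
      case (3 a w')
      have *: "a \<in> carrier H" "\<phi> w' \<in> carrier K"
        using w 3 \<phi>_closed by (auto simp: reduced_words_Cons)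
      have mm: "k (g \<otimes>\<^bsub>H\<^esub> a) \<otimes>\<^bsub>K\<^esub> \<phi> w' = k g \<otimes>\<^bsub>K\<^esub> (k a \<otimes>\<^bsub>K\<^esub> \<phi> w')" if "g \<in> carrier H" for g
        using that * by (simp add: K.m_assoc)
      show ?thesis
      proof (cases x)
        case (Inr g)
        then have g: "g \<in> carrier H" using x by auto
        show ?thesis
        proof (cases "g \<otimes>\<^bsub>H\<^esub> a = \<one>\<^bsub>H\<^esub>")
          case True
          then have "\<phi> w' = k g \<otimes>\<^bsub>K\<^esub> (k a \<otimes>\<^bsub>K\<^esub> \<phi> w')" using mm[OF g] * by simp
          then show ?thesis using True 3 Inr by (simp add: \<phi>_Cons e_def)
        qed (use 3 Inr mm[OF g] in \<open>simp add: \<phi>_Cons e_def\<close>)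
      next
        case (Inl h)
        then show ?thesis using 3 x w1 by (auto simp: \<phi>_Cons e_def)
      qed
    qed
  qed
  have \<phi>_mult: "\<phi> (foldr L u v) = \<phi> u \<otimes>\<^bsub>K\<^esub> \<phi> v"
    if "set u \<subseteq> letters" "v \<in> reduced_words G H" for u v
    using that
  proof (induction u)
    case Nil
    then show ?case using \<phi>_closed by (simp add: \<phi>_Nil)
  next
    case (Cons x u)
    then show ?case using foldr_L_closed[of u v] \<phi>_closed \<phi>_closed' e
      by (simp add: \<phi>_L \<phi>_Cons K.m_assoc)
  qed
  have hom: "\<phi> \<in> hom (free_product G H) K"
    by (rule homI) (auto simp: \<phi>_closed \<phi>_mult letters_of_reduced)
  have \<phi>l: "\<phi> (inl g) = f g" if "g \<in> carrier G" for g
    unfolding inl_def using that by (subst \<phi>_L) (auto simp: \<phi>_Nil e_def)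
  have \<phi>r: "\<phi> (inr g) = k g" if "g \<in> carrier H" for g
    unfolding inr_def using that by (subst \<phi>_L) (auto simp: \<phi>_Nil e_def)
  have uniq: "\<psi> w = \<phi> w"
    if \<psi>: "\<psi> \<in> hom (free_product G H) K" "\<forall>g \<in> carrier G. \<psi> (inl g) = f g"
      "\<forall>h \<in> carrier H. \<psi> (inr h) = k h" and w: "w \<in> reduced_words G H" for \<psi> w
    using w
  proof (induction w)
    case Nil
    have "\<psi> [] = \<one>\<^bsub>K\<^esub>" using hom_one[OF \<psi>(1) group_free_product K] by simp
    then show ?case by (simp add: \<phi>_Nil)
  next
    case (Cons x w)
    then have w: "w \<in> reduced_words G H" and x: "x \<in> letters"
      using reduced_words_ConsD letters_of_reduced by fastforce+
    have xw: "L x w = x # w" using Cons.prems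
      by (cases x; cases w rule: list_sum_cases) (auto simp: reduced_words_Cons)
    have lx: "L x [] \<in> reduced_words G H" using x by (intro L_closed) auto
    have "L x w = L x [] \<otimes>\<^bsub>free_product G H\<^esub> w" using foldr_L_L[OF x _ w, of "[]"] by simp
    then have "\<psi> (x # w) = \<psi> (L x []) \<otimes>\<^bsub>K\<^esub> \<psi> w"
      using hom_mult[OF \<psi>(1), of "L x []" w] lx w xw by simp
    also have "\<psi> (L x []) = e x"
      using x \<psi>(2,3) unfolding inl_def inr_def e_def by (auto simp del: letter_mult.simps)
    finally show ?case using Cons.IH[OF w] by (simp add: \<phi>_Cons)
  qed
  show ?thesis
    unfolding free_product_simps(1) using hom \<phi>l \<phi>r uniq by blast
qed

end

definition finitely_generated :: "('a, 'b) monoid_scheme \<Rightarrow> bool"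
  where "finitely_generated G \<longleftrightarrow> (\<exists>S \<subseteq> carrier G. finite S \<and> generate G S = carrier G)"

text \<open>An order is a relation \<open>r\<close> on the carrier, with \<open>(x, y) \<in> r\<close> standing for \<open>x \<preceq> y\<close>.\<close>

definition strictly_less :: "('a \<times> 'a) set \<Rightarrow> 'a \<Rightarrow> 'a \<Rightarrow> bool"
  where "strictly_less r x y \<longleftrightarrow> (x, y) \<in> r \<and> x \<noteq> y"

definition left_ordering :: "('a, 'b) monoid_scheme \<Rightarrow> ('a \<times> 'a) set \<Rightarrow> bool"
  where "left_ordering G r \<longleftrightarrow>
    linear_order_on (carrier G) r \<and>
    (\<forall>x \<in> carrier G. \<forall>y \<in> carrier G. \<forall>z \<in> carrier G.
      strictly_less r x y \<longrightarrow> strictly_less r (z \<otimes>\<^bsub>G\<^esub> x) (z \<otimes>\<^bsub>G\<^esub> y))"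

definition left_orderable :: "('a, 'b) monoid_scheme \<Rightarrow> bool"
  where "left_orderable G \<longleftrightarrow> (\<exists>r. left_ordering G r)"

definition isolated_left_ordering :: "('a, 'b) monoid_scheme \<Rightarrow> ('a \<times> 'a) set \<Rightarrow> bool"
  where "isolated_left_ordering G r \<longleftrightarrow>
    left_ordering G r \<and>
    (\<exists>F \<subseteq> carrier G. finite F \<and> (\<forall>x \<in> F. strictly_less r \<one>\<^bsub>G\<^esub> x) \<and>
      (\<forall>r'. left_ordering G r' \<and> (\<forall>x \<in> F. strictly_less r' \<one>\<^bsub>G\<^esub> x) \<longrightarrow> r' = r))"

definition positive_cone_char :: "('a, 'b) monoid_scheme \<Rightarrow> ('a \<times> 'a) set \<Rightarrow> 'a \<Rightarrow> bool"
  where "positive_cone_char G r = (\<lambda>x \<in> carrier G. strictly_less r \<one>\<^bsub>G\<^esub> x)"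

text \<open>
  The space of left-orderings carries the topology induced from the product
  \<open>{0,1}\<^bsup>carrier G\<^esup>\<close> of discrete two-point spaces (here \<open>bool\<close>) along \<open>positive_cone_char\<close>.
\<close>

definition LO_space :: "('a, 'b) monoid_scheme \<Rightarrow> ('a \<times> 'a) set topology"
  where "LO_space G =
    pullback_topology {r. left_ordering G r} (positive_cone_char G)
      (product_topology (\<lambda>_. discrete_topology (UNIV :: bool set)) (carrier G))"

text \<open>
  The pullback identifies a left-ordering with its positive cone: \<open>positive_cone_char\<close> lands in the
  product space and is injective on left-orderings.
\<close>

lemma topspace_LO_space: "topspace (LO_space G) = {r. left_ordering G r}"
  by (auto simp: LO_space_def topspace_pullback_topology positive_cone_char_def)

lemma left_ordering_iff_positive:
  assumes "group G" "left_ordering G r" "x \<in> carrier G" "y \<in> carrier G"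
  shows "strictly_less r x y \<longleftrightarrow> strictly_less r \<one>\<^bsub>G\<^esub> (inv\<^bsub>G\<^esub> x \<otimes>\<^bsub>G\<^esub> y)"
proof -
  interpret group G by fact
  have inv: "strictly_less r (z \<otimes>\<^bsub>G\<^esub> a) (z \<otimes>\<^bsub>G\<^esub> b)"
    if "strictly_less r a b" "z \<in> carrier G" "a \<in> carrier G" "b \<in> carrier G" for a b z
    using assms(2) that by (auto simp: left_ordering_def)
  show ?thesis
    using inv[of x y "inv\<^bsub>G\<^esub> x"] inv[of "\<one>\<^bsub>G\<^esub>" "inv\<^bsub>G\<^esub> x \<otimes>\<^bsub>G\<^esub> y" x] assms(3,4)
    by (auto simp: m_assoc[symmetric])
qed

lemma inj_on_positive_cone_char:
  assumes "group G"
  shows "inj_on (positive_cone_char G) {r. left_ordering G r}"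
proof (rule inj_onI, clarify)
  fix r s assume r: "left_ordering G r" and s: "left_ordering G s"
    and eq: "positive_cone_char G r = positive_cone_char G s"
  interpret group G by fact
  have pos: "strictly_less r \<one>\<^bsub>G\<^esub> z \<longleftrightarrow> strictly_less s \<one>\<^bsub>G\<^esub> z" if "z \<in> carrier G" for z
    using fun_cong[OF eq, of z] that by (simp add: positive_cone_char_def)
  have less: "strictly_less r x y \<longleftrightarrow> strictly_less s x y"
    if "x \<in> carrier G" "y \<in> carrier G" for x y
    using left_ordering_iff_positive[OF assms r that] left_ordering_iff_positive[OF assms s that]
      pos[of "inv\<^bsub>G\<^esub> x \<otimes>\<^bsub>G\<^esub> y"] that by simp
  have mem: "(x, y) \<in> t \<longleftrightarrow> x \<in> carrier G \<and> y \<in> carrier G \<and> (x = y \<or> strictly_less t x y)"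
    if "left_ordering G t" for t x y
    using that by (auto simp: left_ordering_def order_on_defs refl_on_def strictly_less_def)
  show "r = s"
    using mem[OF r] mem[OF s] less by (auto simp: set_eq_iff)
qed

fun cantor_stage :: "nat \<Rightarrow> real set"
  where
    "cantor_stage 0 = {0..1}"
  | "cantor_stage (Suc n) =
      (\<lambda>x. x / 3) ` cantor_stage n \<union> (\<lambda>x. 2 / 3 + x / 3) ` cantor_stage n"

definition cantor_set :: "real set"
  where "cantor_set = (\<Inter>n. cantor_stage n)"

end

theory Submission
  imports Defs
begin

text \<open>
  Write \<open>P\<close> for the free product and fix a left-ordering of it that makes the members of a finite set
  \<open>F\<close> positive. Finitely generated groups are countable, so orders can be turned into actions: a countable
  chain on which a group acts by order automorphisms embeds equivariantly into the rationals
  (\<open>rational_realization\<close>, which rests on Cantor's back-and-forth argument, \<open>back_and_forth\<close>).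
  Conversely, an action on the rationals together with a base point gives a left-invariant preorder,
  and a tie-breaking rule makes it a left-ordering (\<open>left_ordering_of_action\<close>).

  The freedom in a free product is that an action of \<open>G\<close> and an action of \<open>H\<close> can be glued without
  any compatibility condition. In particular the \<open>H\<close>-part may first be conjugated by an order
  automorphism of the rationals, and any order-preserving map between finite sets of rationals
  extends to such an automorphism (\<open>glue_actions\<close>).

  No left-ordering is isolated. Realise the given order as an action of \<open>P\<close> with base point \<open>t []\<close>.
  Whether the members of \<open>F\<close> are positive depends only on how letters move the finitely many points
  \<open>t s\<close>, where \<open>s\<close> is a suffix of a word in \<open>F\<close>. Let \<open>m\<close> be the largest such suffix in the given
  order, and choose \<open>g\<close> in \<open>G\<close> and \<open>h\<close> in \<open>H\<close> that move \<open>m\<close> up. Conjugate the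
  action of \<open>H\<close> by an automorphism that fixes all points \<open>t s\<close> and carries \<open>t (h m)\<close> to \<open>t (g m)\<close>. Positivity of \<open>F\<close> survives, but now \<open>g m\<close> and \<open>h m\<close>
  send the base point to the same place. Breaking ties by the original order or by its reverse
  gives two left-orderings that disagree on \<open>g m\<close> and \<open>h m\<close>, and \<open>F\<close> is positive for both.

  The same gluing shows that \<open>P\<close> is left-orderable (\<open>left_orderable_free_product\<close>): given a reduced
  word, actions of \<open>G\<close> and \<open>H\<close> are arranged so that its letters, read from the right, push a point
  up a strictly increasing staircase. Hence every nontrivial element moves a rational in some
  action, and a lexicographic combination of these actions orders \<open>P\<close>.

  For the homeomorphism, left-orderings of a countable group are coded by sequences of bits. The
  codes form a nonempty closed subset of \<open>{0,1}\<^sup>\<nat>\<close>, because being a left-ordering is a condition on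
  finitely many bits at a time, and a perfect one when no left-ordering is isolated. Following the
  branches of its splitting tree parametrises such a set continuously by \<open>{0,1}\<^sup>\<nat>\<close>
  (\<open>perfect_set_parametrization\<close>), which is homeomorphic to the ternary Cantor set by compactness.
\<close>

section \<open>Countable dense chains and the back-and-forth argument\<close>

locale strict_chain =
  fixes A :: "'x set" and lt :: "'x \<Rightarrow> 'x \<Rightarrow> bool"  (infix "\<^bold><" 50)
  assumes irrefl: "a \<in> A \<Longrightarrow> \<not> a \<^bold>< a"
    and trans: "\<lbrakk>a \<in> A; b \<in> A; c \<in> A; a \<^bold>< b; b \<^bold>< c\<rbrakk> \<Longrightarrow> a \<^bold>< c"
    and total: "\<lbrakk>a \<in> A; b \<in> A; a \<noteq> b\<rbrakk> \<Longrightarrow> a \<^bold>< b \<or> b \<^bold>< a"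
begin

lemma asym: "\<lbrakk>a \<in> A; b \<in> A; a \<^bold>< b\<rbrakk> \<Longrightarrow> \<not> b \<^bold>< a"
  using irrefl[of a] trans[of a b a] by metis

lemma dual: "strict_chain A (\<lambda>x y. y \<^bold>< x)"
proof (unfold_locales, goal_cases)
  case (2 a b c)
  then show ?case using trans[of c b a] by metis
qed (use irrefl total in metis)+

lemma finite_has_greatest:
  assumes "finite S" "S \<noteq> {}" "S \<subseteq> A"
  shows "\<exists>m\<in>S. \<forall>s\<in>S. s = m \<or> s \<^bold>< m"
  using assms
proof (induction S rule: finite_ne_induct)
  case (insert x S)
  then obtain m where m: "m \<in> S" "\<forall>s\<in>S. s = m \<or> s \<^bold>< m" by auto
  show ?case
  proof (cases "m \<^bold>< x")
    case True
    have "s \<^bold>< x" if "s \<in> S" for s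
      using that True m insert.prems trans[of s m x] by (cases "s = m") auto
    then show ?thesis by blast
  next
    case False
    then have "x = m \<or> x \<^bold>< m" using total[of x m] m insert.prems by auto
    then show ?thesis using m by blast
  qed
qed simp

end

locale dense_chain = strict_chain +
  assumes nonempty: "A \<noteq> {}"
    and dense: "\<lbrakk>a \<in> A; b \<in> A; a \<^bold>< b\<rbrakk> \<Longrightarrow> \<exists>c\<in>A. a \<^bold>< c \<and> c \<^bold>< b"
    and no_greatest: "a \<in> A \<Longrightarrow> \<exists>b\<in>A. a \<^bold>< b"
    and no_least: "a \<in> A \<Longrightarrow> \<exists>b\<in>A. b \<^bold>< a"
begin

lemma finite_sets_separated:
  assumes "finite L" "finite U" "L \<subseteq> A" "U \<subseteq> A" and LU: "\<And>l u. l \<in> L \<Longrightarrow> u \<in> U \<Longrightarrow> l \<^bold>< u"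
  shows "\<exists>x\<in>A. (\<forall>l\<in>L. l \<^bold>< x) \<and> (\<forall>u\<in>U. x \<^bold>< u)"
proof -
  have top: "\<exists>m\<in>L. \<forall>s\<in>L. s = m \<or> s \<^bold>< m" if "L \<noteq> {}"
    using finite_has_greatest that assms by auto
  have bot: "\<exists>m\<in>U. \<forall>s\<in>U. s = m \<or> m \<^bold>< s" if "U \<noteq> {}"
    using strict_chain.finite_has_greatest[OF dual] that assms by auto
  have up: "\<forall>l\<in>L. l \<^bold>< x" if "m \<in> L" "\<forall>s\<in>L. s = m \<or> s \<^bold>< m" "m \<^bold>< x" "x \<in> A" for m x
  proof
    fix l assume "l \<in> L"
    then show "l \<^bold>< x" using that trans[of l m x] subsetD[OF assms(3)] by metis
  qed
  have dn: "\<forall>u\<in>U. x \<^bold>< u" if "m \<in> U" "\<forall>s\<in>U. s = m \<or> m \<^bold>< s" "x \<^bold>< m" "x \<in> A" for m x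
  proof
    fix u assume "u \<in> U"
    then show "x \<^bold>< u" using that trans[of x m u] subsetD[OF assms(4)] by metis
  qed
  consider "L = {}" "U = {}" | "L \<noteq> {}" "U = {}" | "L = {}" "U \<noteq> {}" | "L \<noteq> {}" "U \<noteq> {}" by blast
  then show ?thesis
  proof cases
    case 1 then show ?thesis using nonempty by auto
  next
    case 2
    then obtain m where m: "m \<in> L" "\<forall>s\<in>L. s = m \<or> s \<^bold>< m" using top by auto
    then obtain x where "x \<in> A" "m \<^bold>< x" using no_greatest assms(3) by blast
    then show ?thesis using up[OF m] 2 by (metis empty_iff)
  next
    case 3
    then obtain m where m: "m \<in> U" "\<forall>s\<in>U. s = m \<or> m \<^bold>< s" using bot by auto
    then obtain x where "x \<in> A" "x \<^bold>< m" using no_least assms(4) by blast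
    then show ?thesis using dn[OF m] 3 by (metis empty_iff)
  next
    case 4
    then obtain m where m: "m \<in> L" "\<forall>s\<in>L. s = m \<or> s \<^bold>< m" using top by auto
    obtain k where k: "k \<in> U" "\<forall>s\<in>U. s = k \<or> k \<^bold>< s" using bot 4 by auto
    obtain x where "x \<in> A" "m \<^bold>< x" "x \<^bold>< k"
      using dense[of m k] LU m(1) k(1) assms(3,4) by blast
    then show ?thesis using up[OF m] dn[OF k] by metis
  qed
qed

end

definition partial_iso ::
    "'x set \<Rightarrow> ('x \<Rightarrow> 'x \<Rightarrow> bool) \<Rightarrow> 'y set \<Rightarrow> ('y \<Rightarrow> 'y \<Rightarrow> bool) \<Rightarrow> ('x \<times> 'y) set \<Rightarrow> bool"
  where "partial_iso A lt B lt' p \<longleftrightarrow>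
    p \<subseteq> A \<times> B \<and> finite p \<and> (\<forall>(a, b)\<in>p. \<forall>(a', b')\<in>p. lt a a' \<longleftrightarrow> lt' b b')"

lemma partial_iso_converse: "partial_iso A lt B lt' p \<Longrightarrow> partial_iso B lt' A lt (p\<inverse>)"
  unfolding partial_iso_def by auto

text \<open>
  The new point splits the finite domain into a lower and an upper part. Their images are separated
  in the dense chain \<open>B\<close>, and any separating point is an admissible image.
\<close>

lemma partial_iso_extend_domain:
  assumes A: "strict_chain A lt" and B: "dense_chain B lt'" and p: "partial_iso A lt B lt' p"
    and a: "a \<in> A"
  shows "\<exists>p'. partial_iso A lt B lt' p' \<and> p \<subseteq> p' \<and> a \<in> Domain p'"
proof (cases "a \<in> Domain p")
  case False
  interpret A: strict_chain A lt by fact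
  interpret B: dense_chain B lt' by fact
  define L where "L = {b. \<exists>a'. (a', b) \<in> p \<and> lt a' a}"
  define U where "U = {b. \<exists>a'. (a', b) \<in> p \<and> lt a a'}"
  have pAB: "p \<subseteq> A \<times> B" and fin: "finite p"
    and pi: "\<And>a b a' b'. (a, b) \<in> p \<Longrightarrow> (a', b') \<in> p \<Longrightarrow> lt a a' \<longleftrightarrow> lt' b b'"
    using p unfolding partial_iso_def by auto
  have "L \<subseteq> snd ` p" "U \<subseteq> snd ` p" by (force simp: L_def U_def)+
  moreover have "snd ` p \<subseteq> B" "finite (snd ` p)" using pAB fin by auto
  ultimately have LU: "finite L" "finite U" "L \<subseteq> B" "U \<subseteq> B"
    by (auto intro: finite_subset)
  have "lt' l u" if "l \<in> L" "u \<in> U" for l u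
  proof -
    from that obtain a1 a2 where *: "(a1, l) \<in> p" "lt a1 a" "(a2, u) \<in> p" "lt a a2"
      by (auto simp: L_def U_def)
    then have "lt a1 a2" using A.trans[of a1 a a2] a pAB by auto
    then show ?thesis using pi * by blast
  qed
  then obtain b where b: "b \<in> B" "\<forall>l\<in>L. lt' l b" "\<forall>u\<in>U. lt' b u"
    using B.finite_sets_separated[OF LU] by blast
  have new: "(lt a a' \<longleftrightarrow> lt' b b') \<and> (lt a' a \<longleftrightarrow> lt' b' b)" if "(a', b') \<in> p" for a' b'
  proof -
    have ab: "a' \<in> A" "b' \<in> B" "a' \<noteq> a" using that pAB False by auto
    then consider "lt a' a" | "lt a a'" using A.total a by blast
    then show ?thesis
    proof cases
      case 1
      then have "lt' b' b" using b that by (auto simp: L_def)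
      then show ?thesis using 1 A.asym[of a' a] B.asym[of b' b] ab a b by auto
    next
      case 2
      then have "lt' b b'" using b that by (auto simp: U_def)
      then show ?thesis using 2 A.asym[of a a'] B.asym[of b b'] ab a b by auto
    qed
  qed
  have "partial_iso A lt B lt' (insert (a, b) p)"
    unfolding partial_iso_def using pAB fin pi new a b(1) A.irrefl[OF a] B.irrefl[OF b(1)] by auto
  then show ?thesis by blast
qed (use p in blast)

text \<open>
  Cantor's argument. Extending alternately to the next element of \<open>A\<close> and, applied to the converse, to
  the next element of \<open>B\<close> produces an increasing chain of finite partial isomorphisms whose union
  is total on both sides. Starting from \<open>p\<close> gives control over finitely many values, which is what
  the later constructions exploit.
\<close>

theorem back_and_forth:
  assumes A: "dense_chain A lt" "countable A" and B: "dense_chain B lt'" "countable B"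
    and p: "partial_iso A lt B lt' p"
  shows "\<exists>f. bij_betw f A B \<and> (\<forall>a\<in>A. \<forall>a'\<in>A. lt a a' \<longleftrightarrow> lt' (f a) (f a')) \<and>
    (\<forall>(a, b)\<in>p. f a = b)"
proof -
  interpret A: dense_chain A lt by fact
  interpret B: dense_chain B lt' by fact
  have step: "\<exists>p'. partial_iso A lt B lt' p' \<and> p0 \<subseteq> p' \<and>
      from_nat_into A n \<in> Domain p' \<and> from_nat_into B n \<in> Range p'"
    if p0: "partial_iso A lt B lt' p0" for p0 n
  proof -
    obtain p1 where p1: "partial_iso A lt B lt' p1" "p0 \<subseteq> p1" "from_nat_into A n \<in> Domain p1"
      using partial_iso_extend_domain[OF A.strict_chain_axioms B(1) p0 from_nat_into[OF A.nonempty]]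
      by blast
    obtain p2 where p2: "partial_iso B lt' A lt p2" "p1\<inverse> \<subseteq> p2" "from_nat_into B n \<in> Domain p2"
      using partial_iso_extend_domain[OF B.strict_chain_axioms A(1)
          partial_iso_converse[OF p1(1)] from_nat_into[OF B.nonempty]] by blast
    show ?thesis
      by (rule exI[of _ "p2\<inverse>"]) (use p1 p2 partial_iso_converse[OF p2(1)] in auto)
  qed
  have "\<exists>P. \<forall>n. (partial_iso A lt B lt' (P n) \<and> (n = 0 \<longrightarrow> P n = p)) \<and>
      (P n \<subseteq> P (Suc n) \<and> from_nat_into A n \<in> Domain (P (Suc n)) \<and>
        from_nat_into B n \<in> Range (P (Suc n)))"
    by (rule dependent_nat_choice) (use p step in auto)
  then obtain P where P: "\<And>n. partial_iso A lt B lt' (P n)" and P0: "P 0 = p"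
    and P_Suc: "\<And>n. P n \<subseteq> P (Suc n) \<and> from_nat_into A n \<in> Domain (P (Suc n)) \<and>
      from_nat_into B n \<in> Range (P (Suc n))"
    by blast
  have mono: "P m \<subseteq> P n" if "m \<le> n" for m n
    using lift_Suc_mono_le[of P, OF _ that] P_Suc by blast
  define R where "R = (\<Union>n. P n)"
  have RAB: "R \<subseteq> A \<times> B" using P by (auto simp: R_def partial_iso_def)
  have R: "lt a a' \<longleftrightarrow> lt' b b'" if "(a, b) \<in> R" "(a', b') \<in> R" for a b a' b'
  proof -
    from that obtain m n where "(a, b) \<in> P m" "(a', b') \<in> P n" by (auto simp: R_def)
    then have "(a, b) \<in> P (max m n)" "(a', b') \<in> P (max m n)" using mono by (meson max.cobounded1 max.cobounded2 subsetD)+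
    then show ?thesis using P[of "max m n"] unfolding partial_iso_def by blast
  qed
  have dom: "a \<in> Domain R" if a: "a \<in> A" for a
  proof -
    obtain n where "from_nat_into A n = a" using from_nat_into_surj[OF A(2) a] by blast
    then show ?thesis using P_Suc[of n] by (auto simp: R_def)
  qed
  have ran: "b \<in> Range R" if b: "b \<in> B" for b
  proof -
    obtain n where "from_nat_into B n = b" using from_nat_into_surj[OF B(2) b] by blast
    then show ?thesis using P_Suc[of n] by (auto simp: R_def)
  qed
  define f where "f a = (SOME b. (a, b) \<in> R)" for a
  have f: "(a, f a) \<in> R" if "a \<in> A" for a
    using dom[OF that] unfolding f_def by (metis DomainE someI)
  have uniq: "b = b'" if "(a, b) \<in> R" "(a, b') \<in> R" for a b b'
  proof -
    have ab: "a \<in> A" "b \<in> B" "b' \<in> B" using that RAB by auto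
    show ?thesis
      using R[OF that] R[OF that(2) that(1)] A.irrefl[OF ab(1)] B.total[OF ab(2) ab(3)] by auto
  qed
  have uniq': "a = a'" if "(a, b) \<in> R" "(a', b) \<in> R" for a a' b
  proof -
    have ab: "b \<in> B" "a \<in> A" "a' \<in> A" using that RAB by auto
    show ?thesis
      using R[OF that] R[OF that(2) that(1)] B.irrefl[OF ab(1)] A.total[OF ab(2) ab(3)] by auto
  qed
  have "bij_betw f A B"
  proof (rule bij_betwI')
    show "(f x = f y) = (x = y)" if "x \<in> A" "y \<in> A" for x y
      using uniq' f[OF that(1)] f[OF that(2)] by auto
    show "f x \<in> B" if "x \<in> A" for x using f[OF that] RAB by auto
    show "\<exists>x\<in>A. y = f x" if y: "y \<in> B" for y
    proof -
      obtain x where x: "(x, y) \<in> R" using ran[OF y] by auto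
      then have "x \<in> A" using RAB by auto
      then show ?thesis using uniq[OF x f] by blast
    qed
  qed
  moreover have "f a = b" if "(a, b) \<in> p" for a b
  proof -
    have "(a, b) \<in> R" using that P0 by (auto simp: R_def)
    then show ?thesis using uniq f RAB by blast
  qed
  ultimately show ?thesis using R f by blast
qed

section \<open>Actions on the rationals by order automorphisms\<close>

definition rat_automorphisms :: "(rat \<Rightarrow> rat) monoid"
  where "rat_automorphisms = \<lparr>carrier = {f. strict_mono f \<and> surj f}, mult = (\<circ>), one = id\<rparr>"

lemma rat_automorphisms_simps [simp]:
  "f \<in> carrier rat_automorphisms \<longleftrightarrow> strict_mono f \<and> surj f"
  "f \<otimes>\<^bsub>rat_automorphisms\<^esub> g = f \<circ> g"
  "\<one>\<^bsub>rat_automorphisms\<^esub> = id"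
  by (simp_all add: rat_automorphisms_def)

lemma inverse_of_rat_automorphism:
  fixes f :: "rat \<Rightarrow> rat"
  assumes "strict_mono f" "surj f"
  obtains g where "strict_mono g" "surj g" "\<And>x. g (f x) = x" "\<And>x. f (g x) = x"
proof -
  have bij: "bij f" using assms strict_mono_imp_inj_on by (auto simp: bij_def)
  define g where "g = the_inv f"
  have gf: "g (f x) = x" for x using bij by (simp add: g_def bij_is_inj the_inv_f_f)
  have fg: "f (g x) = x" for x using bij by (simp add: g_def bij_is_inj bij_is_surj f_the_inv_into_f)
  have "strict_mono g"
    by (rule strict_monoI) (metis assms(1) fg strict_mono_less)
  moreover have "surj g" using gf by (metis surjI)
  ultimately show thesis using that gf fg by blast
qed

lemma comp_rat_automorphism:
  fixes f g :: "rat \<Rightarrow> rat"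
  assumes "strict_mono f" "surj f" "strict_mono g" "surj g"
  shows "strict_mono (f \<circ> g)" "surj (f \<circ> g)"
  using assms(1,3) comp_surj[OF assms(4,2)] by (simp_all add: strict_mono_def)

lemma group_rat_automorphisms: "group rat_automorphisms"
proof (rule groupI)
  fix f assume "f \<in> carrier rat_automorphisms"
  then have "strict_mono f" "surj f" by auto
  then obtain g where "strict_mono g" "surj g" "\<And>x. g (f x) = x"
    by (rule inverse_of_rat_automorphism) blast
  then show "\<exists>g\<in>carrier rat_automorphisms.
      g \<otimes>\<^bsub>rat_automorphisms\<^esub> f = \<one>\<^bsub>rat_automorphisms\<^esub>"
    by (intro bexI[of _ g]) auto
qed (use comp_rat_automorphism in \<open>auto simp: strict_mono_def o_assoc simp del: o_apply\<close>)

lemma dense_chain_rat: "dense_chain (UNIV :: rat set) (<)"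
proof
  show "\<exists>c\<in>UNIV. a < c \<and> c < b" if "a < b" for a b :: rat using dense[OF that] by auto
  show "\<exists>b\<in>UNIV. a < b" for a :: rat using gt_ex[of a] by auto
  show "\<exists>b\<in>UNIV. b < a" for a :: rat using lt_ex[of a] by auto
qed auto

lemma extend_to_rat_automorphism:
  assumes "finite p" and "\<And>x y x' y'. (x, y) \<in> p \<Longrightarrow> (x', y') \<in> p \<Longrightarrow> x < x' \<longleftrightarrow> y < y'"
  obtains \<phi> :: "rat \<Rightarrow> rat" where "strict_mono \<phi>" "surj \<phi>" "\<And>x y. (x, y) \<in> p \<Longrightarrow> \<phi> x = y"
proof -
  have "partial_iso UNIV (<) UNIV (<) p" using assms unfolding partial_iso_def by auto
  then obtain \<phi> where \<phi>: "bij \<phi>" "\<forall>a a'. a < a' \<longleftrightarrow> \<phi> a < \<phi> a'" "\<forall>(x, y)\<in>p. \<phi> x = y"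
    using back_and_forth[OF dense_chain_rat _ dense_chain_rat, of p] by auto
  have "strict_mono \<phi>" using \<phi>(2) by (simp add: strict_mono_def)
  moreover have "surj \<phi>" using \<phi>(1) by (simp add: bij_is_surj)
  moreover have "\<And>x y. (x, y) \<in> p \<Longrightarrow> \<phi> x = y" using \<phi>(3) by auto
  ultimately show thesis by (rule that)
qed

text \<open>
  Replacing every point by a copy of the rationals makes a chain dense and unbounded. The
  replacement is functorial, so any action by order automorphisms carries over.
\<close>

lemma (in strict_chain) dense_chain_lex_rat:
  assumes "A \<noteq> {}"
  shows "dense_chain (A \<times> (UNIV :: rat set)) (\<lambda>(a, q) (b, s). a \<^bold>< b \<or> a = b \<and> q < s)"
    (is "dense_chain ?D ?lt")
proof
  show "\<not> ?lt x x" if "x \<in> ?D" for x using that irrefl by auto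
  show "?lt x z" if "x \<in> ?D" "y \<in> ?D" "z \<in> ?D" "?lt x y" "?lt y z" for x y z
    using that trans[of "fst x" "fst y" "fst z"] by (auto split: prod.splits)
  show "?lt x y \<or> ?lt y x" if "x \<in> ?D" "y \<in> ?D" "x \<noteq> y" for x y
    using that by (cases x; cases y) (use total linorder_neqE in blast)
  show "?D \<noteq> {}" using assms by auto
  show "\<exists>z\<in>?D. ?lt x z \<and> ?lt z y" if xy: "x \<in> ?D" "y \<in> ?D" "?lt x y" for x y
  proof (cases "fst x = fst y")
    case True
    then have "snd x < snd y" using xy irrefl by (auto split: prod.splits)
    then obtain q where "snd x < q" "q < snd y" using dense by blast
    then show ?thesis using xy True by (intro bexI[of _ "(fst x, q)"]) (auto split: prod.splits)
  next
    case False
    then show ?thesis using xy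
      by (intro bexI[of _ "(fst x, snd x + 1)"]) (auto split: prod.splits)
  qed
  show "\<exists>y\<in>?D. ?lt x y" if "x \<in> ?D" for x
    using that by (intro bexI[of _ "(fst x, snd x + 1)"]) (auto split: prod.splits)
  show "\<exists>y\<in>?D. ?lt y x" if "x \<in> ?D" for x
    using that by (intro bexI[of _ "(fst x, snd x - 1)"]) (auto split: prod.splits)
qed

text \<open>
  Dynamical realisation over the rationals: the countable chain \<open>A\<close> is thickened to a dense one, on
  which \<open>G\<close> still acts, and the thickened chain is identified with the rationals by back-and-forth.
\<close>

theorem rational_realization:
  assumes G: "group G" and A: "strict_chain A lt" "countable A" "A \<noteq> {}"
    and act_closed: "\<And>g a. g \<in> carrier G \<Longrightarrow> a \<in> A \<Longrightarrow> act g a \<in> A"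
    and act_mult: "\<And>g h a. g \<in> carrier G \<Longrightarrow> h \<in> carrier G \<Longrightarrow> a \<in> A \<Longrightarrow>
      act (g \<otimes>\<^bsub>G\<^esub> h) a = act g (act h a)"
    and act_one: "\<And>a. a \<in> A \<Longrightarrow> act \<one>\<^bsub>G\<^esub> a = a"
    and act_mono: "\<And>g a b. g \<in> carrier G \<Longrightarrow> a \<in> A \<Longrightarrow> b \<in> A \<Longrightarrow> lt a b \<Longrightarrow> lt (act g a) (act g b)"
  obtains \<rho> and t :: "'x \<Rightarrow> rat" where "\<rho> \<in> hom G rat_automorphisms"
    and "\<And>a b. a \<in> A \<Longrightarrow> b \<in> A \<Longrightarrow> lt a b \<longleftrightarrow> t a < t b"
    and "\<And>g a. g \<in> carrier G \<Longrightarrow> a \<in> A \<Longrightarrow> \<rho> g (t a) = t (act g a)"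
proof -
  interpret G: group G by fact
  interpret A: strict_chain A lt by fact
  define D where "D = A \<times> (UNIV :: rat set)"
  define less where "less = (\<lambda>(a, q :: rat) (b, s). lt a b \<or> a = b \<and> q < s)"
  have "dense_chain D less"
    unfolding D_def less_def using A.dense_chain_lex_rat[OF A(3)] .
  moreover have "countable D" using A(2) by (simp add: D_def)
  moreover have "partial_iso D less (UNIV :: rat set) (<) {}" by (simp add: partial_iso_def)
  ultimately obtain f where f: "bij_betw f D (UNIV :: rat set)"
      and f_less: "\<And>x y. x \<in> D \<Longrightarrow> y \<in> D \<Longrightarrow> less x y \<longleftrightarrow> f x < f y"
    using back_and_forth[OF _ _ dense_chain_rat, of D less "{}"] by auto
  define e where "e = the_inv_into D f"
  have inj: "inj_on f D" and im: "f ` D = UNIV" using f by (auto simp: bij_betw_def)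
  have e: "e x \<in> D" "f (e x) = x" for x
    using the_inv_into_into[OF inj, of x D] f_the_inv_into_f[OF inj, of x] im by (auto simp: e_def)
  have ef: "e (f z) = z" if "z \<in> D" for z
    using the_inv_into_f_f[OF inj that] by (simp add: e_def)
  define move where "move g = (\<lambda>(a, q :: rat). (act g a, q))" for g
  define \<rho> where "\<rho> g x = f (move g (e x))" for g x
  define t where "t a = f (a, 0)" for a
  have move: "move g z \<in> D" if "g \<in> carrier G" "z \<in> D" for g z
    using that act_closed by (auto simp: move_def D_def)
  have move_mult: "move (g \<otimes>\<^bsub>G\<^esub> h) z = move g (move h z)"
    if "g \<in> carrier G" "h \<in> carrier G" "z \<in> D" for g h z
    using that act_mult by (auto simp: move_def D_def)
  have \<rho>_mult: "\<rho> (g \<otimes>\<^bsub>G\<^esub> h) = \<rho> g \<circ> \<rho> h" if "g \<in> carrier G" "h \<in> carrier G" for g h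
    by (rule ext) (simp add: \<rho>_def that ef move move_mult e)
  have \<rho>_one: "\<rho> \<one>\<^bsub>G\<^esub> = id"
  proof
    fix x
    have "move \<one>\<^bsub>G\<^esub> (e x) = e x" using e(1)[of x] act_one by (auto simp: move_def D_def)
    then show "\<rho> \<one>\<^bsub>G\<^esub> x = id x" by (simp add: \<rho>_def e)
  qed
  have \<rho>_mono: "strict_mono (\<rho> g)" if g: "g \<in> carrier G" for g
  proof (rule strict_monoI)
    fix x y :: rat assume "x < y"
    then have "less (e x) (e y)" using f_less[OF e(1) e(1)] e(2) by simp
    then have "less (move g (e x)) (move g (e y))"
      using e(1)[of x] e(1)[of y] act_mono[OF g] by (auto simp: less_def move_def D_def)
    then show "\<rho> g x < \<rho> g y" using f_less move[OF g] e(1) by (simp add: \<rho>_def)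
  qed
  have \<rho>_surj: "surj (\<rho> g)" if g: "g \<in> carrier G" for g
  proof (rule surjI)
    show "\<rho> g (\<rho> (inv\<^bsub>G\<^esub> g) x) = x" for x
      using \<rho>_mult[of g "inv\<^bsub>G\<^esub> g"] g \<rho>_one by (auto dest: fun_cong[of _ _ x])
  qed
  show thesis
  proof (rule that)
    show "\<rho> \<in> hom G rat_automorphisms" by (rule homI) (simp_all add: \<rho>_mono \<rho>_surj \<rho>_mult)
    show "lt a b \<longleftrightarrow> t a < t b" if "a \<in> A" "b \<in> A" for a b
      using f_less[of "(a, 0)" "(b, 0)"] that by (simp add: t_def less_def D_def)
    show "\<rho> g (t a) = t (act g a)" if "g \<in> carrier G" "a \<in> A" for g a
      using that ef[of "(a, 0)"] by (simp add: t_def \<rho>_def move_def D_def)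
  qed
qed

lemma hom_rat_automorphisms:
  assumes "\<rho> \<in> hom G rat_automorphisms" "g \<in> carrier G"
  shows "strict_mono (\<rho> g)" "surj (\<rho> g)"
  using hom_in_carrier[OF assms] by auto

lemma hom_rat_automorphisms_mult:
  assumes "\<rho> \<in> hom G rat_automorphisms" "g \<in> carrier G" "h \<in> carrier G"
  shows "\<rho> (g \<otimes>\<^bsub>G\<^esub> h) x = \<rho> g (\<rho> h x)"
  using hom_mult[OF assms] by simp

lemma hom_rat_automorphisms_one:
  assumes "group G" "\<rho> \<in> hom G rat_automorphisms"
  shows "\<rho> \<one>\<^bsub>G\<^esub> x = x"
  using hom_one[OF assms(2,1) group_rat_automorphisms] by simp

lemma conjugate_action:
  assumes \<rho>: "\<rho> \<in> hom H rat_automorphisms" and \<phi>: "strict_mono \<phi>" "surj \<phi>"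
  obtains \<rho>' where "\<rho>' \<in> hom H rat_automorphisms"
    and "\<And>h x. h \<in> carrier H \<Longrightarrow> \<rho>' h (\<phi> x) = \<phi> (\<rho> h x)"
proof -
  obtain \<psi> where \<psi>: "strict_mono \<psi>" "surj \<psi>" "\<And>x. \<psi> (\<phi> x) = x" "\<And>x. \<phi> (\<psi> x) = x"
    using inverse_of_rat_automorphism[OF \<phi>] by metis
  have "(\<lambda>h. \<phi> \<circ> \<rho> h \<circ> \<psi>) \<in> hom H rat_automorphisms"
  proof (rule homI)
    fix h k assume hk: "h \<in> carrier H" "k \<in> carrier H"
    show "\<phi> \<circ> \<rho> h \<circ> \<psi> \<in> carrier rat_automorphisms"
      unfolding rat_automorphisms_simps
      by (intro conjI comp_rat_automorphism hom_rat_automorphisms[OF \<rho> hk(1)] \<phi> \<psi>)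
    show "\<phi> \<circ> \<rho> (h \<otimes>\<^bsub>H\<^esub> k) \<circ> \<psi> =
        (\<phi> \<circ> \<rho> h \<circ> \<psi>) \<otimes>\<^bsub>rat_automorphisms\<^esub> (\<phi> \<circ> \<rho> k \<circ> \<psi>)"
      using hom_rat_automorphisms_mult[OF \<rho> hk] \<psi>(3) by (auto simp: fun_eq_iff)
  qed
  then show thesis using that[of "\<lambda>h. \<phi> \<circ> \<rho> h \<circ> \<psi>"] \<psi>(3) by simp
qed

context free_product_groups
begin

text \<open>
  The map \<open>p\<close> extends to an order automorphism \<open>\<phi>\<close> of the rationals. Replacing the action of \<open>H\<close> by its
  \<open>\<phi>\<close>-conjugate costs nothing, since the universal property imposes no relation between the two
  factors; whatever \<open>H\<close> did inside the domain of \<open>p\<close> is now done inside its range.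
\<close>

lemma glue_actions:
  assumes \<rho>G: "\<rho>G \<in> hom G rat_automorphisms" and \<rho>H: "\<rho>H \<in> hom H rat_automorphisms"
    and p: "finite p" "\<And>x y x' y'. (x, y) \<in> p \<Longrightarrow> (x', y') \<in> p \<Longrightarrow> x < x' \<longleftrightarrow> y < y'"
  obtains \<Phi> where "\<Phi> \<in> hom (free_product G H) rat_automorphisms"
    and "\<And>g. g \<in> carrier G \<Longrightarrow> \<Phi> (inl g) = \<rho>G g"
    and "\<And>h x y x' y'. h \<in> carrier H \<Longrightarrow> (x, y) \<in> p \<Longrightarrow> (x', y') \<in> p \<Longrightarrow> \<rho>H h x = x' \<Longrightarrow>
      \<Phi> (inr h) y = y'"
proof -
  obtain \<phi> where \<phi>: "strict_mono \<phi>" "surj \<phi>" "\<And>x y. (x, y) \<in> p \<Longrightarrow> \<phi> x = y"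
    using extend_to_rat_automorphism[OF p] by metis
  obtain \<rho>' where \<rho>': "\<rho>' \<in> hom H rat_automorphisms"
      "\<And>h x. h \<in> carrier H \<Longrightarrow> \<rho>' h (\<phi> x) = \<phi> (\<rho>H h x)"
    using conjugate_action[OF \<rho>H \<phi>(1,2)] by metis
  obtain \<Phi> where "\<Phi> \<in> hom (free_product G H) rat_automorphisms"
      "\<And>g. g \<in> carrier G \<Longrightarrow> \<Phi> (inl g) = \<rho>G g" "\<And>h. h \<in> carrier H \<Longrightarrow> \<Phi> (inr h) = \<rho>' h"
    using free_product_universal[OF group_rat_automorphisms \<rho>G \<rho>'(1)] by blast
  then show thesis using that[of \<Phi>] \<phi>(3) \<rho>'(2) by metis
qed

lemma Cons_eq_mult:
  assumes "x # w \<in> reduced_words G H"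
  shows "[x] \<in> reduced_words G H" and "x # w = [x] \<otimes>\<^bsub>free_product G H\<^esub> w"
    and "[x] = case_sum inl inr x"
  using assms
  by (cases x; cases w rule: list_sum_cases; auto simp: reduced_words_Cons inl_def inr_def)+

end

section \<open>Left-orderings as strict chains; countability of finitely generated groups\<close>

definition weak_order :: "'x set \<Rightarrow> ('x \<Rightarrow> 'x \<Rightarrow> bool) \<Rightarrow> ('x \<times> 'x) set"
  where "weak_order A lt = {(x, y). x \<in> A \<and> y \<in> A \<and> (x = y \<or> lt x y)}"

lemma strictly_less_weak_order:
  assumes "strict_chain A lt" "x \<in> A" "y \<in> A"
  shows "strictly_less (weak_order A lt) x y \<longleftrightarrow> lt x y"
  using assms strict_chain.irrefl[OF assms(1)] by (auto simp: strictly_less_def weak_order_def)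

lemma left_ordering_weak_order:
  assumes G: "group G" and lt: "strict_chain (carrier G) lt"
    and inv: "\<And>x y z. x \<in> carrier G \<Longrightarrow> y \<in> carrier G \<Longrightarrow> z \<in> carrier G \<Longrightarrow> lt x y \<Longrightarrow>
      lt (z \<otimes>\<^bsub>G\<^esub> x) (z \<otimes>\<^bsub>G\<^esub> y)"
  shows "left_ordering G (weak_order (carrier G) lt)"
proof -
  interpret group G by fact
  interpret strict_chain "carrier G" lt by fact
  let ?r = "weak_order (carrier G) lt"
  have "refl_on (carrier G) ?r" "?r \<subseteq> carrier G \<times> carrier G"
    by (auto simp: refl_on_def weak_order_def)
  moreover have "trans ?r"
    by (rule transI) (use trans in \<open>auto simp: weak_order_def\<close>)
  moreover have "antisym ?r"
    by (rule antisymI) (use asym in \<open>auto simp: weak_order_def\<close>)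
  moreover have "total_on (carrier G) ?r"
    using total by (auto simp: total_on_def weak_order_def)
  ultimately show ?thesis
    using inv by (auto simp: left_ordering_def order_on_defs strictly_less_weak_order[OF lt])
qed

lemma strict_chain_left_ordering:
  assumes "left_ordering G r"
  shows "strict_chain (carrier G) (strictly_less r)"
proof -
  have lin: "linear_order_on (carrier G) r" using assms by (simp add: left_ordering_def)
  then have "trans r" "antisym r" "total_on (carrier G) r" by (simp_all add: order_on_defs)
  then show ?thesis
    by unfold_locales
      (auto simp: strictly_less_def total_on_def dest: transD[of r] antisymD[of r])
qed

lemma left_ordering_mult:
  assumes "left_ordering G r" "x \<in> carrier G" "y \<in> carrier G" "z \<in> carrier G" "strictly_less r x y"
  shows "strictly_less r (z \<otimes>\<^bsub>G\<^esub> x) (z \<otimes>\<^bsub>G\<^esub> y)"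
  using assms by (simp add: left_ordering_def)

lemma countable_finitely_generated:
  assumes "group G" "finitely_generated G"
  shows "countable (carrier G)"
proof -
  interpret group G by fact
  obtain S where S: "S \<subseteq> carrier G" "finite S" "generate G S = carrier G"
    using assms(2) by (auto simp: finitely_generated_def)
  define T where "T = S \<union> m_inv G ` S"
  have T: "T \<subseteq> carrier G" "finite T" using S by (auto simp: T_def)
  define val where "val xs = foldr (\<otimes>\<^bsub>G\<^esub>) xs \<one>\<^bsub>G\<^esub>" for xs
  have val_closed: "val xs \<in> carrier G" if "xs \<in> lists T" for xs
    using that T by (induction xs) (auto simp: val_def)
  have val_append: "val (xs @ ys) = val xs \<otimes>\<^bsub>G\<^esub> val ys" if "xs \<in> lists T" "ys \<in> lists T" for xs ys
    using that(1)
  proof (induction xs)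
    case Nil
    then show ?case using val_closed[OF that(2)] by (simp add: val_def)
  next
    case (Cons x xs)
    then have "x \<in> carrier G" using T by auto
    then show ?case using Cons val_closed[of xs] val_closed[OF that(2)]
      by (simp add: val_def m_assoc)
  qed
  have "g \<in> val ` lists T" if "g \<in> generate G S" for g
    using that
  proof induction
    case one
    then show ?case by (auto simp: val_def intro!: image_eqI[of _ _ "[]"])
  next
    case (incl h)
    then show ?case using S(1) by (auto simp: val_def T_def intro!: image_eqI[of _ _ "[h]"])
  next
    case (inv h)
    then show ?case using S(1) by (auto simp: val_def T_def intro!: image_eqI[of _ _ "[inv\<^bsub>G\<^esub> h]"])
  next
    case (eng h1 h2)
    then obtain xs ys where "xs \<in> lists T" "h1 = val xs" "ys \<in> lists T" "h2 = val ys" by blast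
    then have "h1 \<otimes>\<^bsub>G\<^esub> h2 = val (xs @ ys)" "xs @ ys \<in> lists T" using val_append by auto
    then show ?case by blast
  qed
  then have "carrier G \<subseteq> val ` lists T" using S(3) by auto
  moreover have "countable (val ` lists T)"
    using T(2) by (auto intro: countable_finite)
  ultimately show ?thesis using countable_subset by blast
qed

section \<open>Left-orderability of free products\<close>

text \<open>
  Choose for each of the countably many nontrivial elements an action and a point that it moves.
  Recording the images of all the chosen points maps \<open>K\<close> injectively into sequences of rationals, and
  left multiplication preserves every coordinatewise comparison. The lexicographic order on
  sequences therefore pulls back to a left-ordering.
\<close>

theorem left_orderable_if_moved:
  assumes K: "group K" and count: "countable (carrier K)"
    and moved: "\<And>w. w \<in> carrier K \<Longrightarrow> w \<noteq> \<one>\<^bsub>K\<^esub> \<Longrightarrow> \<exists>\<Phi>\<in>hom K rat_automorphisms. \<exists>p. \<Phi> w p \<noteq> p"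
  shows "left_orderable K"
proof -
  interpret K: group K by fact
  define e where "e = from_nat_into (carrier K)"
  have e: "e n \<in> carrier K" for n by (simp add: e_def from_nat_into K.carrier_not_empty)
  have e_surj: "\<exists>n. e n = w" if w: "w \<in> carrier K" for w
    using from_nat_into_surj[OF count w] by (simp add: e_def)
  have triv: "(\<lambda>_. id) \<in> hom K rat_automorphisms" by (rule homI) (auto simp: strict_mono_def)
  have "\<exists>\<Phi>p. fst \<Phi>p \<in> hom K rat_automorphisms \<and>
      (e n \<noteq> \<one>\<^bsub>K\<^esub> \<longrightarrow> fst \<Phi>p (e n) (snd \<Phi>p) \<noteq> snd \<Phi>p)" for n
  proof (cases "e n = \<one>\<^bsub>K\<^esub>")
    case True
    then show ?thesis using triv by (intro exI[of _ "(\<lambda>_. id, 0)"]) auto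
  next
    case False
    then show ?thesis using moved[OF e] by auto
  qed
  then obtain \<Phi>p where \<Phi>p: "\<And>n. fst (\<Phi>p n) \<in> hom K rat_automorphisms"
      "\<And>n. e n \<noteq> \<one>\<^bsub>K\<^esub> \<Longrightarrow> fst (\<Phi>p n) (e n) (snd (\<Phi>p n)) \<noteq> snd (\<Phi>p n)"
    by metis
  define v where "v g n = fst (\<Phi>p n) g (snd (\<Phi>p n))" for g n
  have v_mult: "v (g \<otimes>\<^bsub>K\<^esub> h) n = fst (\<Phi>p n) g (v h n)" if "g \<in> carrier K" "h \<in> carrier K" for g h n
    using hom_rat_automorphisms_mult[OF \<Phi>p(1) that] by (simp add: v_def)
  have v_less: "v (g \<otimes>\<^bsub>K\<^esub> h) n < v (g \<otimes>\<^bsub>K\<^esub> k) n \<longleftrightarrow> v h n < v k n"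
    if "g \<in> carrier K" "h \<in> carrier K" "k \<in> carrier K" for g h k n
    using hom_rat_automorphisms(1)[OF \<Phi>p(1) that(1)] that by (simp add: v_mult strict_mono_less)
  have v_eq: "v (g \<otimes>\<^bsub>K\<^esub> h) n = v (g \<otimes>\<^bsub>K\<^esub> k) n \<longleftrightarrow> v h n = v k n"
    if "g \<in> carrier K" "h \<in> carrier K" "k \<in> carrier K" for g h k n
    using hom_rat_automorphisms(1)[OF \<Phi>p(1) that(1)] that by (simp add: v_mult strict_mono_eq)
  have v_inj: "\<exists>n. v g n \<noteq> v h n" if gh: "g \<in> carrier K" "h \<in> carrier K" "g \<noteq> h" for g h
  proof -
    \<comment> \<open>Coordinates separate points: left multiplication reduces this to an element that is moved.\<close>
    let ?w = "inv\<^bsub>K\<^esub> g \<otimes>\<^bsub>K\<^esub> h"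
    have w: "?w \<in> carrier K" "h = g \<otimes>\<^bsub>K\<^esub> ?w" using gh by (auto simp: K.m_assoc[symmetric])
    then have "?w \<noteq> \<one>\<^bsub>K\<^esub>" using gh by auto
    moreover obtain n where n: "e n = ?w" using e_surj[OF w(1)] by blast
    ultimately have "v ?w n \<noteq> v \<one>\<^bsub>K\<^esub> n"
      using \<Phi>p(2)[of n] hom_rat_automorphisms_one[OF K \<Phi>p(1)] by (simp add: v_def)
    then have "v (g \<otimes>\<^bsub>K\<^esub> ?w) n \<noteq> v (g \<otimes>\<^bsub>K\<^esub> \<one>\<^bsub>K\<^esub>) n" using v_eq[OF gh(1) w(1) K.one_closed] by simp
    then have "v h n \<noteq> v g n" using w(2)[symmetric] gh by simp
    then show ?thesis by metis
  qed
  define lt where "lt g h \<longleftrightarrow> (\<exists>n. v g n < v h n \<and> (\<forall>m<n. v g m = v h m))" for g h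
  have "strict_chain (carrier K) lt"
  proof
    show "\<not> lt a a" for a by (simp add: lt_def)
    show "lt a c" if ab: "lt a b" and bc: "lt b c" for a b c
    proof -
      obtain n where n: "v a n < v b n" "\<forall>m<n. v a m = v b m" using ab by (auto simp: lt_def)
      obtain k where k: "v b k < v c k" "\<forall>m<k. v b m = v c m" using bc by (auto simp: lt_def)
      have "v a (min n k) < v c (min n k)"
        using n k by (cases n k rule: linorder_cases) (auto simp: min_def)
      moreover have "\<forall>m<min n k. v a m = v c m" using n k by auto
      ultimately show ?thesis by (auto simp: lt_def)
    qed
    show "lt a b \<or> lt b a" if ab: "a \<in> carrier K" "b \<in> carrier K" "a \<noteq> b" for a b
    proof -
      define n where "n = (LEAST n. v a n \<noteq> v b n)"
      have "v a n \<noteq> v b n" unfolding n_def using v_inj[OF ab] by (rule LeastI_ex)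
      moreover have "\<forall>m<n. v a m = v b m" unfolding n_def using not_less_Least by blast
      ultimately show ?thesis unfolding lt_def by (auto simp: neq_iff)
    qed
  qed
  then have "left_ordering K (weak_order (carrier K) lt)"
    by (rule left_ordering_weak_order[OF K]) (auto simp: lt_def v_less v_eq)
  then show ?thesis by (auto simp: left_orderable_def)
qed

text \<open>
  Take one copy of \<open>G\<close> for each natural number, ordered one after the other, and put in copy \<open>j\<close> either
  the order \<open>r\<close> or its reverse, whichever makes \<open>x j\<close> positive. Then \<open>x j\<close> moves the identity of copy
  \<open>j\<close> up within that copy. Since \<open>J\<close> has no two consecutive members, these pairs of points can be
  strung together into one increasing sequence.
\<close>

lemma staircase_action:
  assumes G: "group G" and r: "left_ordering G r" and count: "countable (carrier G)"
    and J: "\<And>j. j \<in> J \<Longrightarrow> x j \<in> carrier G \<and> x j \<noteq> \<one>\<^bsub>G\<^esub> \<and> Suc j \<notin> J"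
  obtains \<rho> and q :: "nat \<Rightarrow> rat" where "\<rho> \<in> hom G rat_automorphisms" "strict_mono q"
    "\<And>j. j \<in> J \<Longrightarrow> \<rho> (x j) (q j) = q (Suc j)"
proof -
  interpret group G by fact
  interpret r: strict_chain "carrier G" "strictly_less r" by (rule strict_chain_left_ordering) fact
  define up where "up i \<longleftrightarrow> strictly_less r \<one>\<^bsub>G\<^esub> (x i)" for i :: nat
  define A where "A = (UNIV :: nat set) \<times> carrier G"
  define less where "less = (\<lambda>(i, g) (j, h). i < j \<or> i = j \<and>
    (if up i then strictly_less r g h else strictly_less r h g))"
  define act where "act g = (\<lambda>(i :: nat, h). (i, g \<otimes>\<^bsub>G\<^esub> h))" for g
  have chain: "strict_chain A less"
  proof
    show "\<not> less a a" if "a \<in> A" for a using that r.irrefl by (auto simp: A_def less_def)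
    show "less a c" if "a \<in> A" "b \<in> A" "c \<in> A" "less a b" "less b c" for a b c
      using that r.trans[of "snd a" "snd b" "snd c"] r.trans[of "snd c" "snd b" "snd a"]
      by (auto simp: A_def less_def split: if_splits)
    show "less a b \<or> less b a" if "a \<in> A" "b \<in> A" "a \<noteq> b" for a b
      using that r.total[of "snd a" "snd b"] by (cases a; cases b) (auto simp: A_def less_def)
  qed
  obtain \<rho> and t :: "nat \<times> 'a \<Rightarrow> rat" where \<rho>: "\<rho> \<in> hom G rat_automorphisms"
    and t: "\<And>a b. a \<in> A \<Longrightarrow> b \<in> A \<Longrightarrow> less a b \<longleftrightarrow> t a < t b"
    and \<rho>t: "\<And>g a. g \<in> carrier G \<Longrightarrow> a \<in> A \<Longrightarrow> \<rho> g (t a) = t (act g a)"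
  proof (rule rational_realization[OF G chain, of act])
    show "countable A" "A \<noteq> {}" using count by (auto simp: A_def)
    show "less (act g a) (act g b)" if "g \<in> carrier G" "a \<in> A" "b \<in> A" "less a b" for g a b
      using that left_ordering_mult[OF r]
      by (auto simp: A_def less_def act_def split: if_splits)
  qed (auto simp: A_def act_def m_assoc)
  \<comment> \<open>Step \<open>j\<close> with \<open>j \<in> J\<close> leads from the identity of copy \<open>j\<close> to \<open>x j\<close> in the same copy; any other step
    leads into a later copy. Index \<open>0\<close> is special only because no step leads there.\<close>
  define pos where
    "pos j = (case j of 0 \<Rightarrow> (0, \<one>\<^bsub>G\<^esub>) | Suc i \<Rightarrow> if i \<in> J then (i, x i) else (Suc i, \<one>\<^bsub>G\<^esub>))" for j
  have pos_A: "pos j \<in> A" for j using J by (auto simp: pos_def A_def split: nat.split)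
  have pos_J: "pos j = (j, \<one>\<^bsub>G\<^esub>)" "pos (Suc j) = (j, x j)" if "j \<in> J" for j
    using that J by (auto simp: pos_def split: nat.split)
  have "less (pos j) (pos (Suc j))" for j
  proof (cases "j \<in> J")
    case True
    then show ?thesis
      using pos_J[OF True] J[OF True] r.total[of "\<one>\<^bsub>G\<^esub>" "x j"] by (auto simp: less_def up_def)
  next
    case False
    moreover have "fst (pos j) \<le> j" by (auto simp: pos_def split: nat.split)
    ultimately show ?thesis by (auto simp: less_def pos_def[of "Suc j"] split: prod.split)
  qed
  then have "t (pos j) < t (pos (Suc j))" for j using t pos_A by blast
  then have "strict_mono (\<lambda>j. t (pos j))" by (simp add: strict_mono_Suc_iff)
  moreover have "\<rho> (x j) (t (pos j)) = t (pos (Suc j))" if "j \<in> J" for j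
    using that J \<rho>t[OF _ pos_A, of "x j" j] by (simp add: pos_J act_def)
  ultimately show thesis using that \<rho> by blast
qed

context free_product_groups
begin

lemma countable_reduced_words:
  assumes "countable (carrier G)" "countable (carrier H)"
  shows "countable (reduced_words G H)"
proof -
  have "reduced_words G H \<subseteq> lists letters" using letters_of_reduced by auto
  moreover have "countable (lists letters)" using assms by (intro countable_lists) auto
  ultimately show ?thesis using countable_subset by blast
qed

lemma drop_reduced: "w \<in> reduced_words G H \<Longrightarrow> drop n w \<in> reduced_words G H"
proof (induction w arbitrary: n)
  case (Cons x w)
  then show ?case using reduced_words_ConsD[OF Cons.prems] by (cases n) auto
qed simp

text \<open>
  The letters of \<open>w\<close> alternate between the factors, so the positions of the \<open>G\<close>-letters and those of
  the \<open>H\<close>-letters each have no two consecutive members, and each factor has a staircase for its own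
  letters. Gluing the two actions so that the staircases coincide makes all of \<open>w\<close> climb.
\<close>

lemma reduced_word_moves_point:
  assumes r: "left_ordering G r" and s: "left_ordering H s"
    and count: "countable (carrier G)" "countable (carrier H)"
    and w: "w \<in> reduced_words G H" "w \<noteq> []"
  shows "\<exists>\<Phi>\<in>hom (free_product G H) rat_automorphisms. \<exists>p. \<Phi> w p \<noteq> p"
proof -
  define n where "n = length w"
  \<comment> \<open>Letters are counted from the right, in the order in which they act.\<close>
  define letter where "letter j = w ! (n - Suc j)" for j
  define JG where "JG = {j. j < n \<and> isl (letter j)}"
  define JH where "JH = {j. j < n \<and> \<not> isl (letter j)}"
  have in_w: "letter j \<in> set w" if "j < n" for j using that by (simp add: letter_def n_def)
  have w_letters: "set w \<subseteq> Inl ` (carrier G - {\<one>\<^bsub>G\<^esub>}) \<union> Inr ` (carrier H - {\<one>\<^bsub>H\<^esub>})"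
    and alt: "\<And>i. Suc i < n \<Longrightarrow> isl (w ! i) \<noteq> isl (w ! Suc i)"
    using w(1) by (auto simp: reduced_words_def successively_conv_nth n_def)
  have alternate: "isl (letter j) \<noteq> isl (letter (Suc j))" if "Suc j < n" for j
  proof -
    have "Suc (n - Suc (Suc j)) = n - Suc j" using that by auto
    then show ?thesis using alt[of "n - Suc (Suc j)"] that by (simp add: letter_def)
  qed
  have JG: "projl (letter j) \<in> carrier G \<and> projl (letter j) \<noteq> \<one>\<^bsub>G\<^esub> \<and> Suc j \<notin> JG"
    if "j \<in> JG" for j
    using that in_w[of j] w_letters alternate[of j] by (auto simp: JG_def)
  have JH: "projr (letter j) \<in> carrier H \<and> projr (letter j) \<noteq> \<one>\<^bsub>H\<^esub> \<and> Suc j \<notin> JH"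
    if "j \<in> JH" for j
    using that in_w[of j] w_letters alternate[of j] by (auto simp: JH_def)
  obtain \<rho>G and qG :: "nat \<Rightarrow> rat" where \<rho>G: "\<rho>G \<in> hom G rat_automorphisms" "strict_mono qG"
      "\<And>j. j \<in> JG \<Longrightarrow> \<rho>G (projl (letter j)) (qG j) = qG (Suc j)"
    by (rule staircase_action[OF G.group_axioms r count(1), of JG "\<lambda>j. projl (letter j)"]) (use JG in blast)+
  obtain \<rho>H and qH :: "nat \<Rightarrow> rat" where \<rho>H: "\<rho>H \<in> hom H rat_automorphisms" "strict_mono qH"
      "\<And>j. j \<in> JH \<Longrightarrow> \<rho>H (projr (letter j)) (qH j) = qH (Suc j)"
    by (rule staircase_action[OF H.group_axioms s count(2), of JH "\<lambda>j. projr (letter j)"]) (use JH in blast)+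
  define p where "p = (\<lambda>j. (qH j, qG j)) ` {..n}"
  have fin: "finite p" by (simp add: p_def)
  have mono: "x < x' \<longleftrightarrow> y < y'" if "(x, y) \<in> p" "(x', y') \<in> p" for x y x' y'
    using that \<rho>G(2) \<rho>H(2) by (auto simp: p_def strict_mono_less)
  obtain \<Phi> where \<Phi>: "\<Phi> \<in> hom (free_product G H) rat_automorphisms"
    and \<Phi>l: "\<And>g. g \<in> carrier G \<Longrightarrow> \<Phi> (inl g) = \<rho>G g"
    and \<Phi>r: "\<And>h x y x' y'. h \<in> carrier H \<Longrightarrow> (x, y) \<in> p \<Longrightarrow> (x', y') \<in> p \<Longrightarrow> \<rho>H h x = x' \<Longrightarrow>
      \<Phi> (inr h) y = y'"
    by (rule glue_actions[OF \<rho>G(1) \<rho>H(1) fin mono]) blast+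
  have "\<Phi> (drop (n - j) w) (qG 0) = qG j" if "j \<le> n" for j
    using that
  proof (induction j)
    case 0
    then show ?case using hom_rat_automorphisms_one[OF group_free_product \<Phi>] by (simp add: n_def)
  next
    case (Suc j)
    then have j: "j < n" by simp
    let ?u = "drop (n - j) w"
    have "drop (n - Suc j) w = letter j # ?u"
      using Cons_nth_drop_Suc[of "n - Suc j" w] j by (simp add: letter_def n_def Suc_diff_Suc)
    moreover from this have red: "letter j # ?u \<in> reduced_words G H"
      using drop_reduced[OF w(1)] by metis
    ultimately have "\<Phi> (drop (n - Suc j) w) (qG 0) = \<Phi> [letter j] (\<Phi> ?u (qG 0))"
      using hom_rat_automorphisms_mult[OF \<Phi>, of "[letter j]" ?u] Cons_eq_mult[OF red]
        drop_reduced[OF w(1)] by simp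
    also have "\<dots> = \<Phi> (case_sum inl inr (letter j)) (qG j)"
      using Suc Cons_eq_mult(3)[OF red] by simp
    also have "\<dots> = qG (Suc j)"
    proof (cases "letter j")
      case (Inl g)
      then have "j \<in> JG" using j by (simp add: JG_def)
      then show ?thesis using Inl \<Phi>l JG[of j] \<rho>G(3)[of j] by simp
    next
      case (Inr h)
      then have "j \<in> JH" using j by (simp add: JH_def)
      then show ?thesis
        using Inr \<Phi>r[of h "qH j" "qG j" "qH (Suc j)" "qG (Suc j)"] JH[of j] \<rho>H(3)[of j] j
        by (simp add: p_def)
    qed
    finally show ?case .
  qed
  from this[of n] have "\<Phi> w (qG 0) = qG n" by simp
  moreover have "qG 0 < qG n" using \<rho>G(2) w(2) by (simp add: strict_mono_less n_def)
  ultimately show ?thesis using \<Phi> by (intro bexI[of _ \<Phi>] exI[of _ "qG 0"]) auto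
qed

theorem left_orderable_free_product:
  assumes "left_orderable G" "left_orderable H" "countable (carrier G)" "countable (carrier H)"
  shows "left_orderable (free_product G H)"
proof -
  obtain r s where rs: "left_ordering G r" "left_ordering H s"
    using assms by (auto simp: left_orderable_def)
  show ?thesis
    using reduced_word_moves_point[OF rs assms(3,4)] countable_reduced_words[OF assms(3,4)]
    by (intro left_orderable_if_moved[OF group_free_product]) auto
qed

end

section \<open>Free products have no isolated left-orderings\<close>

text \<open>
  Comparing the images of the base point \<open>p\<close> is left-invariant because the action is monotone; elements
  with equal images lie in one coset of the stabiliser of \<open>p\<close> and are compared by \<open>tie\<close>.
\<close>

lemma left_ordering_of_action:
  assumes K: "group K" and \<Phi>: "\<Phi> \<in> hom K rat_automorphisms"
    and tie: "strict_chain (carrier K) tie"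
    and tie_mult: "\<And>x y z. x \<in> carrier K \<Longrightarrow> y \<in> carrier K \<Longrightarrow> z \<in> carrier K \<Longrightarrow> tie x y \<Longrightarrow>
      tie (z \<otimes>\<^bsub>K\<^esub> x) (z \<otimes>\<^bsub>K\<^esub> y)"
  obtains r where "left_ordering K r"
    and "\<And>x y. x \<in> carrier K \<Longrightarrow> y \<in> carrier K \<Longrightarrow>
      strictly_less r x y \<longleftrightarrow> \<Phi> x p < \<Phi> y p \<or> \<Phi> x p = \<Phi> y p \<and> tie x y"
proof -
  interpret K: group K by fact
  interpret tie: strict_chain "carrier K" tie by fact
  define lt where "lt x y \<longleftrightarrow> \<Phi> x p < \<Phi> y p \<or> \<Phi> x p = \<Phi> y p \<and> tie x y" for x y
  have chain: "strict_chain (carrier K) lt"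
  proof
    show "\<not> lt a a" if "a \<in> carrier K" for a using that tie.irrefl by (simp add: lt_def)
    show "lt a c" if "a \<in> carrier K" "b \<in> carrier K" "c \<in> carrier K" "lt a b" "lt b c" for a b c
      using that tie.trans[of a b c] by (auto simp: lt_def)
    show "lt a b \<or> lt b a" if "a \<in> carrier K" "b \<in> carrier K" "a \<noteq> b" for a b
      using that tie.total[of a b] by (auto simp: lt_def)
  qed
  have "lt (z \<otimes>\<^bsub>K\<^esub> x) (z \<otimes>\<^bsub>K\<^esub> y)"
    if "x \<in> carrier K" "y \<in> carrier K" "z \<in> carrier K" "lt x y" for x y z
    using that tie_mult[of x y z] hom_rat_automorphisms(1)[OF \<Phi>, of z]
    by (auto simp: lt_def hom_rat_automorphisms_mult[OF \<Phi>] strict_mono_less strict_mono_eq)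
  then have "left_ordering K (weak_order (carrier K) lt)"
    by (rule left_ordering_weak_order[OF K chain])
  moreover have "strictly_less (weak_order (carrier K) lt) x y \<longleftrightarrow> lt x y"
    if "x \<in> carrier K" "y \<in> carrier K" for x y
    using strictly_less_weak_order[OF chain that] .
  ultimately show thesis using that unfolding lt_def by blast
qed

text \<open>
  A nontrivial element does not fix \<open>m\<close> under left multiplication, so it or its inverse moves \<open>m\<close> up.
\<close>

lemma nontrivial_image_moves_up:
  assumes P: "group P" and r: "left_ordering P r" and K: "group K" and f: "f \<in> hom K P"
    and g0: "g0 \<in> carrier K" "f g0 \<noteq> \<one>\<^bsub>P\<^esub>" and m: "m \<in> carrier P"
  obtains g where "g \<in> carrier K" "strictly_less r m (f g \<otimes>\<^bsub>P\<^esub> m)"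
proof -
  interpret P: group P by fact
  interpret K: group K by fact
  interpret f: group_hom K P f by unfold_locales (fact f)
  interpret r: strict_chain "carrier P" "strictly_less r" by (rule strict_chain_left_ordering) fact
  have fm: "f g0 \<otimes>\<^bsub>P\<^esub> m \<in> carrier P" "f g0 \<otimes>\<^bsub>P\<^esub> m \<noteq> m" using g0 m by auto
  then consider "strictly_less r m (f g0 \<otimes>\<^bsub>P\<^esub> m)" | "strictly_less r (f g0 \<otimes>\<^bsub>P\<^esub> m) m"
    using r.total m by metis
  then show thesis
  proof cases
    case 1
    then show thesis using that g0 by blast
  next
    case 2
    have "strictly_less r (f (inv\<^bsub>K\<^esub> g0) \<otimes>\<^bsub>P\<^esub> (f g0 \<otimes>\<^bsub>P\<^esub> m)) (f (inv\<^bsub>K\<^esub> g0) \<otimes>\<^bsub>P\<^esub> m)"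
      by (rule left_ordering_mult[OF r fm(1) m _ 2]) (use g0 in auto)
    moreover have "f (inv\<^bsub>K\<^esub> g0) \<otimes>\<^bsub>P\<^esub> (f g0 \<otimes>\<^bsub>P\<^esub> m) = m"
      using g0 m by (simp add: P.m_assoc[symmetric])
    ultimately show thesis using that[of "inv\<^bsub>K\<^esub> g0"] g0 by simp
  qed
qed

text \<open>
  The gluing changes the action without moving the images of the base point under suffixes of words in
  the finite set, but creates a coincidence between two elements \<open>a\<close> and \<open>b\<close> of the free product. The
  order of \<open>a\<close> and \<open>b\<close> is then decided by the tie-breaking rule alone, whereas isolation forces every
  tie-breaking rule to reproduce \<open>r\<close>.
\<close>

theorem (in free_product_groups) free_product_no_isolated_left_ordering:
  assumes nontriv: "carrier G \<noteq> {\<one>\<^bsub>G\<^esub>}" "carrier H \<noteq> {\<one>\<^bsub>H\<^esub>}"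
    and count: "countable (carrier G)" "countable (carrier H)"
  shows "\<not> isolated_left_ordering (free_product G H) r"
proof
  define P where "P = free_product G H"
  have carr: "carrier P = reduced_words G H" and one: "\<one>\<^bsub>P\<^esub> = []" by (simp_all add: P_def)
  have P: "group P" unfolding P_def by (rule group_free_product)
  interpret P: group P by fact
  assume "isolated_left_ordering (free_product G H) r"
  then obtain F where r: "left_ordering P r" and F: "F \<subseteq> carrier P" "finite F"
    and uniq: "\<And>r'. left_ordering P r' \<Longrightarrow> (\<forall>x\<in>F. strictly_less r' [] x) \<Longrightarrow> r' = r"
    and pos: "\<And>x. x \<in> F \<Longrightarrow> strictly_less r [] x"
    unfolding isolated_left_ordering_def P_def[symmetric] one by metis
  interpret r: strict_chain "carrier P" "strictly_less r" by (rule strict_chain_left_ordering) fact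
  obtain \<rho> and t :: "('a + 'b) list \<Rightarrow> rat" where \<rho>: "\<rho> \<in> hom P rat_automorphisms"
    and t: "\<And>a b. a \<in> carrier P \<Longrightarrow> b \<in> carrier P \<Longrightarrow> strictly_less r a b \<longleftrightarrow> t a < t b"
    and \<rho>t: "\<And>g a. g \<in> carrier P \<Longrightarrow> a \<in> carrier P \<Longrightarrow> \<rho> g (t a) = t (g \<otimes>\<^bsub>P\<^esub> a)"
  proof (rule rational_realization[OF P r.strict_chain_axioms, of "\<lambda>g a. g \<otimes>\<^bsub>P\<^esub> a"])
    show "countable (carrier P)" using countable_reduced_words[OF count] by (simp add: carr)
    show "carrier P \<noteq> {}" by (rule P.carrier_not_empty)
  qed (use left_ordering_mult[OF r] in \<open>auto simp: P.m_assoc\<close>)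
  \<comment> \<open>Suffixes are included because a word acts letter by letter from the right; the empty word is
    added so that \<open>S\<close> is nonempty even if \<open>F\<close> is empty.\<close>
  define S where "S = (\<Union>w\<in>insert [] F. (\<lambda>n. drop n w) ` {..length w})"
  have S: "finite S" "S \<subseteq> carrier P"
    using F drop_reduced by (auto simp: S_def carr)
  have S_Nil: "[] \<in> S" by (auto simp: S_def)
  have S_F: "w \<in> S" if "w \<in> F" for w
    using that unfolding S_def by (intro UN_I[of w] image_eqI[of _ _ 0]) auto
  have S_tl: "u \<in> S" if "x # u \<in> S" for x u
  proof -
    from that obtain w n where w: "w \<in> insert [] F" "n \<le> length w" "x # u = drop n w"
      by (auto simp: S_def)
    then have "n < length w" by (cases "n = length w") auto
    moreover have "u = drop (Suc n) w" using w(3) by (metis drop_Suc tl_drop list.sel(3))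
    ultimately show ?thesis using w(1) unfolding S_def by (intro UN_I[of w]) auto
  qed
  obtain m where m: "m \<in> S" "\<forall>s\<in>S. s = m \<or> strictly_less r s m"
    using r.finite_has_greatest[OF S(1) _ S(2)] S_Nil by auto
  have m_carr: "m \<in> carrier P" using m S by auto
  obtain g0 where g0: "g0 \<in> carrier G" "g0 \<noteq> \<one>\<^bsub>G\<^esub>" using nontriv(1) G.one_closed by blast
  obtain h0 where h0: "h0 \<in> carrier H" "h0 \<noteq> \<one>\<^bsub>H\<^esub>" using nontriv(2) H.one_closed by blast
  have inl: "inl \<in> hom G P" and inr: "inr \<in> hom H P" using inl_hom inr_hom by (simp_all add: P_def)
  obtain g where g: "g \<in> carrier G" "strictly_less r m (inl g \<otimes>\<^bsub>P\<^esub> m)"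
    using nontrivial_image_moves_up[OF P r G.group_axioms inl g0(1) _ m_carr] g0
    by (auto simp: inl_def one)
  obtain h where h: "h \<in> carrier H" "strictly_less r m (inr h \<otimes>\<^bsub>P\<^esub> m)"
    using nontrivial_image_moves_up[OF P r H.group_axioms inr h0(1) _ m_carr] h0
    by (auto simp: inr_def one)
  define a where "a = inr h \<otimes>\<^bsub>P\<^esub> m"
  define b where "b = inl g \<otimes>\<^bsub>P\<^esub> m"
  have gh_carr: "inl g \<in> carrier P" "inr h \<in> carrier P"
    using hom_in_carrier[OF inl g(1)] hom_in_carrier[OF inr h(1)] .
  have ab_carr: "a \<in> carrier P" "b \<in> carrier P" using gh_carr m_carr by (auto simp: a_def b_def)
  have "\<not> strictly_less r m ([] \<otimes>\<^bsub>P\<^esub> m)" using r.irrefl m_carr P.l_one by (metis one)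
  then have "inl g \<noteq> []" using g(2) by auto
  then have "inl g \<noteq> inr h" by (auto simp: inl_def inr_def split: if_splits)
  then have ab: "a \<noteq> b" using gh_carr m_carr by (auto simp: a_def b_def)
  have above: "t s < t a \<and> t s < t b" if "s \<in> S" for s
  proof -
    have "t m < t a" "t m < t b" using g(2) h(2) t m_carr ab_carr by (auto simp: a_def b_def)
    moreover have "t s \<le> t m" using m(2) that t[of s m] S(2) m_carr by fastforce
    ultimately show ?thesis by auto
  qed
  \<comment> \<open>Fix the images of all suffixes and carry \<open>t a\<close> to \<open>t b\<close>; this is monotone as both lie above \<open>t m\<close>.\<close>
  define p where "p = insert (t a, t b) ((\<lambda>s. (t s, t s)) ` S)"
  have p: "finite p" using S by (simp add: p_def)
  have p_mono: "x < x' \<longleftrightarrow> y < y'" if "(x, y) \<in> p" "(x', y') \<in> p" for x y x' y'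
    using that above by (fastforce simp: p_def)
  have \<rho>l: "(\<lambda>g. \<rho> (inl g)) \<in> hom G rat_automorphisms"
    and \<rho>r: "(\<lambda>h. \<rho> (inr h)) \<in> hom H rat_automorphisms"
    using hom_compose[OF inl \<rho>] hom_compose[OF inr \<rho>] by (simp_all add: comp_def)
  obtain \<Phi> where \<Phi>: "\<Phi> \<in> hom P rat_automorphisms"
    and \<Phi>l: "\<And>g. g \<in> carrier G \<Longrightarrow> \<Phi> (inl g) = \<rho> (inl g)"
    and \<Phi>r: "\<And>h x y x' y'. h \<in> carrier H \<Longrightarrow> (x, y) \<in> p \<Longrightarrow> (x', y') \<in> p \<Longrightarrow>
      \<rho> (inr h) x = x' \<Longrightarrow> \<Phi> (inr h) y = y'"
    unfolding P_def by (rule glue_actions[OF \<rho>l \<rho>r p p_mono]) blast+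
  \<comment> \<open>Along suffixes the modified action agrees with the original one.\<close>
  have \<Phi>_S: "\<Phi> u (t []) = t u" if "u \<in> S" for u
    using that
  proof (induction u)
    case Nil
    then show ?case using hom_rat_automorphisms_one[OF P \<Phi>] by (simp add: one)
  next
    case (Cons x u)
    note u = S_tl[OF Cons.prems]
    have carrs: "x # u \<in> carrier P" "u \<in> carrier P" using Cons.prems u S by auto
    note xu = Cons_eq_mult[OF carrs(1)[unfolded carr]]
    have x: "[x] \<in> carrier P" "x # u = [x] \<otimes>\<^bsub>P\<^esub> u" using xu by (simp_all add: carr P_def)
    have "\<Phi> (x # u) (t []) = \<Phi> [x] (t u)"
      using hom_rat_automorphisms_mult[OF \<Phi> x(1) carrs(2)] x(2) Cons.IH[OF u] by simp
    also have "\<dots> = t (x # u)"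
    proof (cases x)
      case (Inl k)
      then have "[x] = inl k" "k \<in> carrier G" using xu(1,3) by (auto simp: reduced_words_Cons)
      then show ?thesis using \<Phi>l \<rho>t[OF x(1) carrs(2)] x(2) by simp
    next
      case (Inr k)
      then have k: "[x] = inr k" "k \<in> carrier H" using xu(1,3) by (auto simp: reduced_words_Cons)
      show ?thesis
        unfolding k(1)
        by (rule \<Phi>r[OF k(2), of "t u" _ "t (x # u)"])
          (use u Cons.prems \<rho>t[OF x(1) carrs(2)] x(2) k(1) in \<open>auto simp: p_def\<close>)
    qed
    finally show ?case .
  qed
  have \<Phi>_b: "\<Phi> b (t []) = t b"
    using hom_rat_automorphisms_mult[OF \<Phi> gh_carr(1) m_carr] \<Phi>_S[OF m(1)] \<Phi>l[OF g(1)]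
      \<rho>t[OF gh_carr(1) m_carr] by (simp add: b_def)
  have "\<Phi> (inr h) (t m) = t b"
    by (rule \<Phi>r[OF h(1), of "t m" _ "t a"])
      (use m(1) \<rho>t[OF gh_carr(2) m_carr] in \<open>auto simp: p_def a_def\<close>)
  then have \<Phi>_a: "\<Phi> a (t []) = t b"
    using hom_rat_automorphisms_mult[OF \<Phi> gh_carr(2) m_carr] \<Phi>_S[OF m(1)] by (simp add: a_def)
  have Nil_carr: "[] \<in> carrier P" using S S_Nil by auto
  \<comment> \<open>As \<open>a\<close> and \<open>b\<close> send the base point to \<open>t b\<close>, they are compared by \<open>lt\<close>; by isolation also by \<open>r\<close>.\<close>
  have tie: "strictly_less r a b \<longleftrightarrow> lt a b"
    if lt: "strict_chain (carrier P) lt"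
      and lt_mult: "\<And>x y z. x \<in> carrier P \<Longrightarrow> y \<in> carrier P \<Longrightarrow> z \<in> carrier P \<Longrightarrow> lt x y \<Longrightarrow>
        lt (z \<otimes>\<^bsub>P\<^esub> x) (z \<otimes>\<^bsub>P\<^esub> y)" for lt
  proof -
    obtain r' where r': "left_ordering P r'"
      and r'_less: "\<And>x y. x \<in> carrier P \<Longrightarrow> y \<in> carrier P \<Longrightarrow>
        strictly_less r' x y \<longleftrightarrow> \<Phi> x (t []) < \<Phi> y (t []) \<or> \<Phi> x (t []) = \<Phi> y (t []) \<and> lt x y"
      by (rule left_ordering_of_action[OF P \<Phi> lt lt_mult]) blast+
    have "strictly_less r' [] x" if x: "x \<in> F" for x
    proof -
      have "t [] < t x" using pos[OF x] t[OF Nil_carr] x F(1) by auto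
      then show ?thesis
        using r'_less[OF Nil_carr] \<Phi>_S[OF S_Nil] \<Phi>_S[OF S_F[OF x]] x F(1) by auto
    qed
    then have "r' = r" using uniq r' by blast
    then show ?thesis using r'_less[OF ab_carr] \<Phi>_a \<Phi>_b by simp
  qed
  have "strictly_less r a b \<longleftrightarrow> strictly_less r b a"
    by (rule tie[OF r.dual]) (use left_ordering_mult[OF r] in blast)
  then show False using r.total[OF ab_carr ab] r.asym ab_carr by blast
qed

section \<open>The Cantor space of bit sequences and the ternary Cantor set\<close>

definition cantor_space :: "(nat \<Rightarrow> bool) topology"
  where "cantor_space = product_topology (\<lambda>_. discrete_topology UNIV) UNIV"

lemma topspace_cantor_space [simp]: "topspace cantor_space = UNIV"
  by (simp add: cantor_space_def)

lemma compact_cantor_space: "compact_space cantor_space"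
  by (simp add: cantor_space_def compact_space_product_topology compact_space_discrete_topology)

lemma openin_cantor_space_prefix: "openin cantor_space {y. \<forall>j<n. y j = x j}"
proof -
  have "finite {j. (if j < n then {x j} else UNIV) \<noteq> (UNIV :: bool set)}"
    by (rule finite_subset[of _ "{..<n}"]) auto
  then have "openin cantor_space (\<Pi>\<^sub>E j\<in>UNIV. if j < n then {x j} else UNIV)"
    unfolding cantor_space_def by (intro product_topology_basis) auto
  moreover have "(\<Pi>\<^sub>E j\<in>UNIV. if j < n then {x j} else UNIV) = {y. \<forall>j<n. y j = x j}"
    by (auto simp: PiE_UNIV_domain split: if_splits)
  ultimately show ?thesis by simp
qed

lemma continuous_map_cantor_space:
  assumes "f \<in> UNIV \<rightarrow> topspace Y"
    and "\<And>U x. openin Y U \<Longrightarrow> f x \<in> U \<Longrightarrow> \<exists>n. \<forall>y. (\<forall>j<n. y j = x j) \<longrightarrow> f y \<in> U"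
  shows "continuous_map cantor_space Y f"
  unfolding continuous_map
proof (intro conjI allI impI)
  show "f ` topspace cantor_space \<subseteq> topspace Y" using assms(1) by auto
  fix U assume U: "openin Y U"
  have "\<exists>T. openin cantor_space T \<and> x \<in> T \<and> T \<subseteq> {x. f x \<in> U}" if x: "f x \<in> U" for x
  proof -
    obtain n where "\<forall>y. (\<forall>j<n. y j = x j) \<longrightarrow> f y \<in> U" using assms(2)[OF U x] by blast
    then show ?thesis using openin_cantor_space_prefix[of n x]
      by (intro exI[of _ "{y. \<forall>j<n. y j = x j}"]) auto
  qed
  then show "openin cantor_space {x \<in> topspace cantor_space. f x \<in> U}"
    using openin_subopen[of cantor_space "{x. f x \<in> U}"] by simp
qed

definition cantor_value :: "(nat \<Rightarrow> bool) \<Rightarrow> real"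
  where "cantor_value b = suminf (\<lambda>n. (if b n then 2 else 0) / 3 ^ Suc n)"

lemma summable_cantor_value: "summable (\<lambda>n. (if b n then 2 else 0) / 3 ^ Suc n :: real)"
proof (rule summable_comparison_test')
  show "summable (\<lambda>n. 2 * (1 / 3) ^ Suc n :: real)"
    by (intro summable_mult summable_Suc_iff[THEN iffD2] summable_geometric) simp
  show "norm ((if b n then 2 else 0) / 3 ^ Suc n :: real) \<le> 2 * (1 / 3) ^ Suc n" for n
    by (simp add: power_one_over)
qed

lemma cantor_value_unfold:
  "cantor_value b = (if b 0 then 2 / 3 else 0) + cantor_value (\<lambda>n. b (Suc n)) / 3"
proof -
  have "cantor_value b = (if b 0 then 2 / 3 else 0) +
      suminf (\<lambda>n. (if b (Suc n) then 2 else 0) / 3 ^ Suc (Suc n))"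
    unfolding cantor_value_def using suminf_split_head[OF summable_cantor_value, of b] by auto
  also have "suminf (\<lambda>n. (if b (Suc n) then 2 else 0) / 3 ^ Suc (Suc n) :: real) =
      suminf (\<lambda>n. (if b (Suc n) then 2 else 0) / 3 ^ Suc n / 3)"
    by (rule arg_cong[of _ _ suminf]) (simp add: fun_eq_iff)
  also have "\<dots> = cantor_value (\<lambda>n. b (Suc n)) / 3"
    unfolding cantor_value_def using suminf_divide[OF summable_cantor_value[of "\<lambda>n. b (Suc n)"], of 3] by simp
  finally show ?thesis .
qed

lemma cantor_value_bounds: "0 \<le> cantor_value b" "cantor_value b \<le> 1"
proof -
  show "0 \<le> cantor_value b"
    unfolding cantor_value_def by (intro suminf_nonneg summable_cantor_value) auto
  have geo: "(\<lambda>n. 2 / 3 * (1 / 3) ^ n :: real) sums 1"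
    using sums_mult[OF geometric_sums[of "1 / 3 :: real"], of "2 / 3"] by simp
  have "cantor_value b \<le> suminf (\<lambda>n. 2 / 3 * (1 / 3) ^ n)"
    unfolding cantor_value_def
    by (intro suminf_le summable_cantor_value sums_summable[OF geo]) (auto simp: power_one_over)
  then show "cantor_value b \<le> 1" using sums_unique[OF geo] by simp
qed

lemma cantor_value_prefix:
  assumes "\<And>j. j < n \<Longrightarrow> b j = b' j"
  shows "\<bar>cantor_value b - cantor_value b'\<bar> \<le> (1 / 3) ^ n"
  using assms
proof (induction n arbitrary: b b')
  case 0
  then show ?case using cantor_value_bounds[of b] cantor_value_bounds[of b'] by auto
next
  case (Suc n)
  have "\<bar>cantor_value (\<lambda>n. b (Suc n)) - cantor_value (\<lambda>n. b' (Suc n))\<bar> \<le> (1 / 3) ^ n"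
    by (rule Suc.IH) (use Suc.prems in auto)
  moreover have "b 0 = b' 0" using Suc.prems by auto
  then have "cantor_value b - cantor_value b' =
      (cantor_value (\<lambda>n. b (Suc n)) - cantor_value (\<lambda>n. b' (Suc n))) / 3"
    using cantor_value_unfold[of b] cantor_value_unfold[of b'] by (simp add: diff_divide_distrib)
  then have "\<bar>cantor_value b - cantor_value b'\<bar> =
      \<bar>cantor_value (\<lambda>n. b (Suc n)) - cantor_value (\<lambda>n. b' (Suc n))\<bar> / 3"
    by (simp only: abs_divide abs_numeral)
  ultimately show ?case by simp
qed

lemma inj_cantor_value: "inj cantor_value"
proof (rule injI)
  fix b b' assume "cantor_value b = cantor_value b'"
  then have "b n = b' n" for n
  proof (induction n arbitrary: b b')
    case 0
    then show ?case
      using cantor_value_unfold[of b] cantor_value_unfold[of b']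
        cantor_value_bounds[of "\<lambda>n. b (Suc n)"] cantor_value_bounds[of "\<lambda>n. b' (Suc n)"]
      by (auto split: if_splits)
  next
    case (Suc n)
    then have "cantor_value (\<lambda>n. b (Suc n)) = cantor_value (\<lambda>n. b' (Suc n))"
      using cantor_value_unfold[of b] cantor_value_unfold[of b']
        cantor_value_bounds[of "\<lambda>n. b (Suc n)"] cantor_value_bounds[of "\<lambda>n. b' (Suc n)"]
      by (auto split: if_splits)
    then show ?case using Suc.IH by blast
  qed
  then show "b = b'" by blast
qed

lemma continuous_cantor_value: "continuous_map cantor_space euclideanreal cantor_value"
proof (rule continuous_map_cantor_space)
  fix U and x :: "nat \<Rightarrow> bool" assume "openin euclideanreal U" "cantor_value x \<in> U"
  then obtain e where e: "e > 0" "ball (cantor_value x) e \<subseteq> U"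
    by (auto simp: open_contains_ball)
  obtain n where n: "(1 / 3 :: real) ^ n < e" using real_arch_pow_inv[OF e(1), of "1 / 3"] by auto
  have "cantor_value y \<in> U" if "\<forall>j<n. y j = x j" for y
    using cantor_value_prefix[of n x y] that n e(2) by (auto simp: dist_real_def subset_iff)
  then show "\<exists>n. \<forall>y. (\<forall>j<n. y j = x j) \<longrightarrow> cantor_value y \<in> U" by blast
qed auto

lemma range_cantor_value: "range cantor_value = cantor_set"
proof
  have "cantor_value b \<in> cantor_stage n" for b n
  proof (induction n arbitrary: b)
    case 0
    then show ?case using cantor_value_bounds by auto
  next
    case (Suc n)
    then show ?case
      using cantor_value_unfold[of b] Suc.IH[of "\<lambda>n. b (Suc n)"] by (cases "b 0") auto
  qed
  then show "range cantor_value \<subseteq> cantor_set" by (auto simp: cantor_set_def)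
  \<comment> \<open>Stage \<open>n\<close> lies within \<open>3\<^sup>-\<^sup>n\<close> of the compact image, so the intersection of all stages lies inside it.\<close>
  have near: "\<exists>b. \<bar>x - cantor_value b\<bar> \<le> (1 / 3) ^ n" if "x \<in> cantor_stage n" for x n
    using that
  proof (induction n arbitrary: x)
    case 0
    then show ?case
      using cantor_value_bounds[of "\<lambda>_. False"] by (intro exI[of _ "\<lambda>_. False"]) auto
  next
    case (Suc n)
    then obtain y d where y: "y \<in> cantor_stage n" "x = (if d then 2 / 3 else 0) + y / 3"
      by (auto intro: that[of _ True] that[of _ False])
    then obtain b where b: "\<bar>y - cantor_value b\<bar> \<le> (1 / 3) ^ n" using Suc.IH by blast
    have "cantor_value (case_nat d b) = (if d then 2 / 3 else 0) + cantor_value b / 3"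
      using cantor_value_unfold[of "case_nat d b"] by simp
    then have "x - cantor_value (case_nat d b) = (y - cantor_value b) / 3"
      using y(2) by (simp add: diff_divide_distrib)
    then have "\<bar>x - cantor_value (case_nat d b)\<bar> = \<bar>y - cantor_value b\<bar> / 3"
      by (simp only: abs_divide abs_numeral)
    then have "\<bar>x - cantor_value (case_nat d b)\<bar> \<le> (1 / 3) ^ Suc n" using b by simp
    then show ?case by blast
  qed
  have "compact (range cantor_value)"
    using image_compactin[OF compact_cantor_space[unfolded compact_space_def] continuous_cantor_value]
    by simp
  then have closed: "closed (range cantor_value)" by (rule compact_imp_closed)
  show "cantor_set \<subseteq> range cantor_value"
  proof
    fix x assume x: "x \<in> cantor_set"
    have "\<exists>y\<in>range cantor_value. dist y x < e" if e: "e > 0" for e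
    proof -
      obtain n where n: "(1 / 3 :: real) ^ n < e" using real_arch_pow_inv[OF e, of "1 / 3"] by auto
      obtain b where "\<bar>x - cantor_value b\<bar> \<le> (1 / 3) ^ n" using near[of x n] x by (auto simp: cantor_set_def)
      then show ?thesis using n by (intro bexI[of _ "cantor_value b"]) (auto simp: dist_real_def)
    qed
    then have "x \<in> closure (range cantor_value)" by (simp add: closure_approachable)
    then show "x \<in> range cantor_value" using closed by simp
  qed
qed

text \<open>
  A continuous bijection from a compact space to a Hausdorff space is a homeomorphism, so no
  continuity of the inverse of the ternary expansion has to be checked.
\<close>

theorem cantor_space_homeomorphic_cantor_set:
  "cantor_space homeomorphic_space top_of_set cantor_set"
proof (rule homeomorphic_map_imp_homeomorphic_space)
  show "homeomorphic_map cantor_space (top_of_set cantor_set) cantor_value"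
  proof (rule continuous_imp_homeomorphic_map)
    show "continuous_map cantor_space (top_of_set cantor_set) cantor_value"
      using continuous_cantor_value range_cantor_value
      by (intro continuous_map_into_subtopology) auto
    show "Hausdorff_space (top_of_set cantor_set)" by (simp add: Hausdorff_space_subtopology)
  qed (use compact_cantor_space range_cantor_value inj_cantor_value in auto)
qed

section \<open>Perfect sets of bit sequences\<close>

definition first_split :: "(nat \<Rightarrow> bool) set \<Rightarrow> nat"
  where "first_split Y = (LEAST k. \<exists>x\<in>Y. \<exists>y\<in>Y. x k \<noteq> y k)"

text \<open>
  The node of the splitting tree of \<open>Z\<close> that is reached by the first \<open>n\<close> decisions of \<open>b\<close>, represented by
  the set of members of \<open>Z\<close> passing through it.
\<close>

primrec branch :: "(nat \<Rightarrow> bool) set \<Rightarrow> (nat \<Rightarrow> bool) \<Rightarrow> nat \<Rightarrow> (nat \<Rightarrow> bool) set"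
  where
    "branch Z b 0 = Z"
  | "branch Z b (Suc n) = {x \<in> branch Z b n. x (first_split (branch Z b n)) = b n}"

lemma branch_cong: "(\<And>j. j < n \<Longrightarrow> b j = b' j) \<Longrightarrow> branch Z b n = branch Z b' n"
  by (induction n) auto

lemma branch_antimono: "m \<le> n \<Longrightarrow> branch Z b n \<subseteq> branch Z b m"
  by (rule lift_Suc_antimono_le[of "branch Z b"]) auto

lemma first_split_agree:
  assumes "x \<in> Y" "y \<in> Y" "i < first_split Y"
  shows "x i = y i"
  using assms not_less_Least[of i "\<lambda>k. \<exists>x\<in>Y. \<exists>y\<in>Y. x k \<noteq> y k"] by (auto simp: first_split_def)

text \<open>
  Every node of the splitting tree is nonempty and relatively open, so by perfectness it has two
  different members and splits again, each time at a later coordinate. A sequence of decisions thus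
  determines all coordinates, and closedness puts the resulting point into \<open>Z\<close>. The \<open>i\<close>th coordinate is
  settled after \<open>i + 1\<close> decisions, which makes \<open>\<psi>\<close> continuous.
\<close>

theorem perfect_set_parametrization:
  fixes Z :: "(nat \<Rightarrow> bool) set"
  assumes ne: "Z \<noteq> {}"
    and perfect: "\<And>x n. x \<in> Z \<Longrightarrow> \<exists>y\<in>Z. y \<noteq> x \<and> (\<forall>i<n. y i = x i)"
    and closed: "\<And>x. (\<And>n. \<exists>y\<in>Z. \<forall>i<n. y i = x i) \<Longrightarrow> x \<in> Z"
  obtains \<psi> :: "(nat \<Rightarrow> bool) \<Rightarrow> nat \<Rightarrow> bool" where "bij_betw \<psi> UNIV Z"
    and "\<And>i b b'. (\<And>j. j \<le> i \<Longrightarrow> b j = b' j) \<Longrightarrow> \<psi> b i = \<psi> b' i"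
proof -
  have branch_subset: "branch Z b n \<subseteq> Z" for b n using branch_antimono[of 0 n Z b] by simp
  have branch_open: "\<exists>m. \<forall>x\<in>branch Z b n. \<forall>y\<in>Z. (\<forall>i<m. y i = x i) \<longrightarrow> y \<in> branch Z b n" for b n
  proof (induction n)
    case (Suc n)
    then obtain m where "\<forall>x\<in>branch Z b n. \<forall>y\<in>Z. (\<forall>i<m. y i = x i) \<longrightarrow> y \<in> branch Z b n" by blast
    then show ?case
      by (intro exI[of _ "max m (Suc (first_split (branch Z b n)))"]) auto
  qed simp
  have splits: "\<exists>x\<in>branch Z b n. \<exists>y\<in>branch Z b n.
      x (first_split (branch Z b n)) \<noteq> y (first_split (branch Z b n))"
    if ne: "branch Z b n \<noteq> {}" for b n
  proof -
    obtain x where x: "x \<in> branch Z b n" using ne by blast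
    obtain m where m: "\<forall>x\<in>branch Z b n. \<forall>y\<in>Z. (\<forall>i<m. y i = x i) \<longrightarrow> y \<in> branch Z b n"
      using branch_open by blast
    obtain y where y: "y \<in> Z" "y \<noteq> x" "\<forall>i<m. y i = x i" using perfect x branch_subset by blast
    then have "y \<in> branch Z b n" using m x by blast
    moreover obtain k where "x k \<noteq> y k" using y(2) by blast
    ultimately have "\<exists>k. \<exists>x\<in>branch Z b n. \<exists>y\<in>branch Z b n. x k \<noteq> y k" using x by blast
    then show ?thesis unfolding first_split_def by (rule LeastI_ex)
  qed
  have branch_ne: "branch Z b n \<noteq> {}" for b n
  proof (induction n)
    case (Suc n)
    obtain x y where xy: "x \<in> branch Z b n" "y \<in> branch Z b n"
        "x (first_split (branch Z b n)) \<noteq> y (first_split (branch Z b n))"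
      using splits[OF Suc] by blast
    then have "x \<in> branch Z b (Suc n) \<or> y \<in> branch Z b (Suc n)" by auto
    then show ?case by blast
  qed (simp add: ne)
  have split_less: "first_split (branch Z b n) < first_split (branch Z b (Suc n))" for b n
  proof (rule ccontr)
    assume "\<not> ?thesis"
    then have le: "first_split (branch Z b (Suc n)) \<le> first_split (branch Z b n)" by simp
    obtain x y where xy: "x \<in> branch Z b (Suc n)" "y \<in> branch Z b (Suc n)"
        "x (first_split (branch Z b (Suc n))) \<noteq> y (first_split (branch Z b (Suc n)))"
      using splits[OF branch_ne] by blast
    then show False
      using first_split_agree[of x "branch Z b n" y] le by (cases "first_split (branch Z b (Suc n)) = first_split (branch Z b n)") auto
  qed
  have split_ge: "n \<le> first_split (branch Z b n)" for b n
    using split_less by (intro strict_mono_imp_increasing) (simp add: strict_mono_Suc_iff)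
  define \<psi> where "\<psi> b i = (SOME x. x \<in> branch Z b (Suc i)) i" for b i
  have \<psi>: "\<psi> b i = x i" if x: "x \<in> branch Z b n" and n: "i < n" for b i n x
  proof -
    have "(SOME x. x \<in> branch Z b (Suc i)) \<in> branch Z b (Suc i)"
      using branch_ne by (simp add: some_in_eq del: branch.simps)
    moreover have "x \<in> branch Z b (Suc i)" using x branch_antimono[of "Suc i" n Z b] n by auto
    moreover have "i < first_split (branch Z b (Suc i))" using split_ge[of "Suc i" b] by simp
    ultimately show ?thesis unfolding \<psi>_def by (rule first_split_agree)
  qed
  have \<psi>_in: "\<psi> b \<in> Z" for b
  proof (rule closed)
    fix n
    obtain x where x: "x \<in> branch Z b n" using branch_ne[of b n] by blast
    moreover have "\<forall>i<n. x i = \<psi> b i" using \<psi>[OF x] by metis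
    ultimately show "\<exists>y\<in>Z. \<forall>i<n. y i = \<psi> b i" using branch_subset by blast
  qed
  have \<psi>_branch: "\<psi> b \<in> branch Z b n" for b n
  proof (induction n)
    case (Suc n)
    let ?k = "first_split (branch Z b n)"
    obtain x where x: "x \<in> branch Z b (max (Suc n) (Suc ?k))"
      using branch_ne[of b "max (Suc n) (Suc ?k)"] by blast
    then have "x \<in> branch Z b (Suc n)" using branch_antimono[of "Suc n" "max (Suc n) (Suc ?k)" Z b] by auto
    moreover have "\<psi> b ?k = x ?k" using \<psi>[OF x] by simp
    ultimately show ?case using Suc by simp
  qed (simp add: \<psi>_in)
  show thesis
  proof (rule that)
    show "bij_betw \<psi> UNIV Z"
    proof (rule bij_betwI')
      fix b b' :: "nat \<Rightarrow> bool"
      show "(\<psi> b = \<psi> b') = (b = b')"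
      proof
        assume eq: "\<psi> b = \<psi> b'"
        have "b n = b' n" for n
        proof (induction n rule: less_induct)
          case (less n)
          then have "branch Z b n = branch Z b' n" by (rule branch_cong)
          then show ?case using \<psi>_branch[of b "Suc n"] \<psi>_branch[of b' "Suc n"] eq by simp
        qed
        then show "b = b'" by blast
      qed simp
    next
      fix x assume x: "x \<in> Z"
      define N where "N = rec_nat Z (\<lambda>_ Y. {y \<in> Y. y (first_split Y) = x (first_split Y)})"
      have N: "N 0 = Z" "N (Suc n) = {y \<in> N n. y (first_split (N n)) = x (first_split (N n))}" for n
        by (simp_all add: N_def)
      define b where "b n = x (first_split (N n))" for n
      have bN: "branch Z b n = N n" for n by (induction n) (auto simp: N b_def)
      have "x \<in> N n" for n using x by (induction n) (auto simp: N)
      then have "\<psi> b i = x i" for i using \<psi>[of x b "Suc i" i] unfolding bN by simp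
      then have "x = \<psi> b" by auto
      then show "\<exists>b\<in>UNIV. x = \<psi> b" by blast
    qed (use \<psi>_in in auto)
    show "\<psi> b i = \<psi> b' i" if "\<And>j. j \<le> i \<Longrightarrow> b j = b' j" for i b b'
      using branch_cong[of "Suc i" b b' Z] that by (simp add: \<psi>_def)
  qed
qed

section \<open>The space of left-orderings\<close>

lemma left_ordering_inv_iff:
  assumes "group K" "left_ordering K r" "g \<in> carrier K"
  shows "strictly_less r \<one>\<^bsub>K\<^esub> (inv\<^bsub>K\<^esub> g) \<longleftrightarrow> strictly_less r g \<one>\<^bsub>K\<^esub>"
  using left_ordering_iff_positive[OF assms(1,2,3), of "\<one>\<^bsub>K\<^esub>"] assms
  by (simp add: group.is_monoid)

text \<open>
  Irreflexivity, transitivity, totality and left invariance each involve only finitely many elements at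
  a time, so a predicate that locally looks like a positive cone is one. This is the closedness of
  the space of left-orderings in the product space.
\<close>

lemma left_ordering_of_local_positivity:
  assumes K: "group K"
    and approx: "\<And>T. finite T \<Longrightarrow> T \<subseteq> carrier K \<Longrightarrow>
      \<exists>r. left_ordering K r \<and> (\<forall>g\<in>T. pos g \<longleftrightarrow> strictly_less r \<one>\<^bsub>K\<^esub> g)"
  obtains r where "left_ordering K r"
    and "\<And>g. g \<in> carrier K \<Longrightarrow> strictly_less r \<one>\<^bsub>K\<^esub> g \<longleftrightarrow> pos g"
proof -
  interpret K: group K by fact
  define lt where "lt x y \<longleftrightarrow> pos (inv\<^bsub>K\<^esub> x \<otimes>\<^bsub>K\<^esub> y)" for x y
  have local: "\<exists>r. left_ordering K r \<and> (\<forall>x\<in>T. \<forall>y\<in>T. lt x y \<longleftrightarrow> strictly_less r x y)"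
    if T: "finite T" "T \<subseteq> carrier K" for T
  proof -
    let ?D = "(\<lambda>(x, y). inv\<^bsub>K\<^esub> x \<otimes>\<^bsub>K\<^esub> y) ` (T \<times> T)"
    have "finite ?D" "?D \<subseteq> carrier K" using T by auto
    then obtain r where r: "left_ordering K r" "\<forall>g\<in>?D. pos g \<longleftrightarrow> strictly_less r \<one>\<^bsub>K\<^esub> g"
      using approx by blast
    have "lt x y \<longleftrightarrow> strictly_less r x y" if "x \<in> T" "y \<in> T" for x y
      using r(2) left_ordering_iff_positive[OF K r(1), of x y] that T(2) by (auto simp: lt_def)
    then show ?thesis using r(1) by blast
  qed
  have chain: "strict_chain (carrier K) lt"
  proof
    show "\<not> lt a a" if a: "a \<in> carrier K" for a
    proof -
      obtain r where "left_ordering K r" "lt a a \<longleftrightarrow> strictly_less r a a"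
        using local[of "{a}"] a by auto
      then show ?thesis using strict_chain.irrefl[OF strict_chain_left_ordering] a by metis
    qed
    show "lt a c" if abc: "a \<in> carrier K" "b \<in> carrier K" "c \<in> carrier K" "lt a b" "lt b c" for a b c
    proof -
      obtain r where r: "left_ordering K r" "\<forall>x\<in>{a, b, c}. \<forall>y\<in>{a, b, c}. lt x y \<longleftrightarrow> strictly_less r x y"
        using local[of "{a, b, c}"] abc by auto
      then show ?thesis
        using strict_chain.trans[OF strict_chain_left_ordering[OF r(1)], of a b c] abc by auto
    qed
    show "lt a b \<or> lt b a" if ab: "a \<in> carrier K" "b \<in> carrier K" "a \<noteq> b" for a b
    proof -
      obtain r where r: "left_ordering K r" "\<forall>x\<in>{a, b}. \<forall>y\<in>{a, b}. lt x y \<longleftrightarrow> strictly_less r x y"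
        using local[of "{a, b}"] ab by auto
      then show ?thesis
        using strict_chain.total[OF strict_chain_left_ordering[OF r(1)], of a b] ab by auto
    qed
  qed
  have "left_ordering K (weak_order (carrier K) lt)"
  proof (rule left_ordering_weak_order[OF K chain])
    fix x y z assume xyz: "x \<in> carrier K" "y \<in> carrier K" "z \<in> carrier K" and "lt x y"
    have "inv\<^bsub>K\<^esub> z \<otimes>\<^bsub>K\<^esub> (z \<otimes>\<^bsub>K\<^esub> y) = y" using xyz by (simp add: K.m_assoc[symmetric])
    then have "inv\<^bsub>K\<^esub> (z \<otimes>\<^bsub>K\<^esub> x) \<otimes>\<^bsub>K\<^esub> (z \<otimes>\<^bsub>K\<^esub> y) = inv\<^bsub>K\<^esub> x \<otimes>\<^bsub>K\<^esub> y"
      using xyz by (simp add: K.inv_mult_group K.m_assoc)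
    then show "lt (z \<otimes>\<^bsub>K\<^esub> x) (z \<otimes>\<^bsub>K\<^esub> y)" using \<open>lt x y\<close> by (simp add: lt_def)
  qed
  moreover have "strictly_less (weak_order (carrier K) lt) \<one>\<^bsub>K\<^esub> g \<longleftrightarrow> pos g" if "g \<in> carrier K" for g
    using strictly_less_weak_order[OF chain K.one_closed that] that by (simp add: lt_def)
  ultimately show thesis by (rule that)
qed

text \<open>
  Reading positivity along an enumeration \<open>e\<close> of the group, possibly with repetitions, codes
  left-orderings by bit sequences. Closedness of the set of codes is local positivity; perfectness is
  the absence of isolated orderings, where agreement on \<open>n\<close> bits is expressed by positivity of
  finitely many elements and inverses.
\<close>

theorem LO_space_homeomorphic_cantor_set:
  assumes K: "group K" and count: "countable (carrier K)" and lo: "left_orderable K"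
    and no_isolated: "\<And>r. \<not> isolated_left_ordering K r"
  shows "LO_space K homeomorphic_space top_of_set cantor_set"
proof -
  interpret K: group K by fact
  define LO where "LO = {r. left_ordering K r}"
  define e where "e = from_nat_into (carrier K)"
  have e: "e n \<in> carrier K" for n by (simp add: e_def from_nat_into K.carrier_not_empty)
  have "\<exists>n. e n = g" if g: "g \<in> carrier K" for g
    using from_nat_into_surj[OF count g] by (simp add: e_def)
  then obtain idx where idx: "\<And>g. g \<in> carrier K \<Longrightarrow> e (idx g) = g" by metis
  define code where "code r n = strictly_less r \<one>\<^bsub>K\<^esub> (e n)" for r n
  have char_code: "positive_cone_char K r g = code r (idx g)" if "g \<in> carrier K" for r g
    using that by (simp add: positive_cone_char_def code_def idx)
  have inj: "inj_on code LO"
  proof (rule inj_onI)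
    fix r s assume rs: "r \<in> LO" "s \<in> LO" "code r = code s"
    have "positive_cone_char K r = positive_cone_char K s"
    proof
      fix g show "positive_cone_char K r g = positive_cone_char K s g"
        using rs(3) by (cases "g \<in> carrier K") (simp_all add: char_code, simp add: positive_cone_char_def)
    qed
    then show "r = s" using inj_on_positive_cone_char[OF K] rs by (auto simp: LO_def inj_on_def)
  qed
  obtain \<psi> :: "(nat \<Rightarrow> bool) \<Rightarrow> nat \<Rightarrow> bool" where \<psi>: "bij_betw \<psi> UNIV (code ` LO)"
    and \<psi>_local: "\<And>i b b'. (\<And>j. j \<le> i \<Longrightarrow> b j = b' j) \<Longrightarrow> \<psi> b i = \<psi> b' i"
  proof (rule perfect_set_parametrization[of "code ` LO"])
    show "code ` LO \<noteq> {}" using lo by (auto simp: left_orderable_def LO_def)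
    show "\<exists>y\<in>code ` LO. y \<noteq> x \<and> (\<forall>i<n. y i = x i)" if "x \<in> code ` LO" for x n
    proof -
      obtain r where r: "left_ordering K r" "x = code r" using \<open>x \<in> code ` LO\<close> by (auto simp: LO_def)
      define F where "F = {g \<in> e ` {..<n} \<union> m_inv K ` e ` {..<n}. strictly_less r \<one>\<^bsub>K\<^esub> g}"
      have "finite F" "F \<subseteq> carrier K" "\<forall>g\<in>F. strictly_less r \<one>\<^bsub>K\<^esub> g" using e by (auto simp: F_def)
      then obtain r' where r': "left_ordering K r'" "\<forall>g\<in>F. strictly_less r' \<one>\<^bsub>K\<^esub> g" "r' \<noteq> r"
        using no_isolated[of r] r(1) unfolding isolated_left_ordering_def by metis
      interpret r: strict_chain "carrier K" "strictly_less r"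
        by (rule strict_chain_left_ordering) fact
      interpret r': strict_chain "carrier K" "strictly_less r'"
        by (rule strict_chain_left_ordering) fact
      have "code r' i = code r i" if "i < n" for i
      proof -
        consider "strictly_less r \<one>\<^bsub>K\<^esub> (e i)" | "strictly_less r (e i) \<one>\<^bsub>K\<^esub>" | "e i = \<one>\<^bsub>K\<^esub>"
          using r.total[OF K.one_closed e] by metis
        then show ?thesis
        proof cases
          case 1
          then have "e i \<in> F" using that by (auto simp: F_def)
          then show ?thesis using 1 r'(2) by (auto simp: code_def)
        next
          case 2
          then have "inv\<^bsub>K\<^esub> (e i) \<in> F"
            using that left_ordering_inv_iff[OF K r(1) e] by (auto simp: F_def)
          then have "strictly_less r' (e i) \<one>\<^bsub>K\<^esub>"
            using r'(2) left_ordering_inv_iff[OF K r'(1) e] by auto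
          then show ?thesis
            using 2 r.asym[OF e K.one_closed] r'.asym[OF e K.one_closed] by (simp add: code_def)
        next
          case 3
          then show ?thesis using r.irrefl r'.irrefl by (simp add: code_def)
        qed
      qed
      moreover have "code r' \<noteq> code r" using inj r(1) r'(1,3) by (auto simp: LO_def inj_on_def)
      ultimately show ?thesis using r'(1) r(2) by (auto simp: LO_def)
    qed
    show "x \<in> code ` LO" if approx: "\<And>n. \<exists>y\<in>code ` LO. \<forall>i<n. y i = x i" for x
    proof -
      have near: "\<exists>r. left_ordering K r \<and> (\<forall>i\<in>I. x i \<longleftrightarrow> strictly_less r \<one>\<^bsub>K\<^esub> (e i))"
        if I: "finite I" for I
      proof -
        obtain n where n: "\<forall>i\<in>I. i < n" using finite_nat_bounded[OF I] by blast
        then show ?thesis using approx[of n] by (auto simp: LO_def code_def)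
      qed
      have "\<exists>r. left_ordering K r \<and> (\<forall>g\<in>T. x (idx g) \<longleftrightarrow> strictly_less r \<one>\<^bsub>K\<^esub> g)"
        if "finite T" "T \<subseteq> carrier K" for T
        using near[of "idx ` T"] that idx by (auto simp: subset_iff)
      then obtain r where r: "left_ordering K r"
          "\<And>g. g \<in> carrier K \<Longrightarrow> strictly_less r \<one>\<^bsub>K\<^esub> g \<longleftrightarrow> x (idx g)"
        by (rule left_ordering_of_local_positivity[OF K]) blast+
      have "x (idx (e n)) = x n" for n
        using near[of "{n, idx (e n)}"] idx[OF e[of n]] by auto
      then have "code r = x" using r(2) e by (auto simp: code_def fun_eq_iff)
      then show ?thesis using r(1) by (auto simp: LO_def)
    qed
  qed blast
  define \<Psi> where "\<Psi> = inv_into LO code \<circ> \<psi>"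
  have bij: "bij_betw \<Psi> UNIV LO"
    unfolding \<Psi>_def using \<psi> bij_betw_inv_into[OF inj_on_imp_bij_betw[OF inj]] by (rule bij_betw_trans)
  have code_\<Psi>: "code (\<Psi> b) = \<psi> b" for b
    using \<psi> by (auto simp: \<Psi>_def bij_betw_def intro: f_inv_into_f)
  have "homeomorphic_map cantor_space (LO_space K) \<Psi>"
  proof (rule continuous_imp_homeomorphic_map)
    show "continuous_map cantor_space (LO_space K) \<Psi>"
      unfolding LO_space_def
    proof (rule continuous_map_pullback')
      show "topspace cantor_space \<subseteq> \<Psi> -` {r. left_ordering K r}"
        using bij by (auto simp: bij_betw_def LO_def)
      have "continuous_map cantor_space (discrete_topology UNIV)
          (\<lambda>b. positive_cone_char K (\<Psi> b) g)" if "g \<in> carrier K" for g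
      proof (rule continuous_map_cantor_space)
        fix U x assume U: "positive_cone_char K (\<Psi> x) g \<in> U"
        have "positive_cone_char K (\<Psi> y) g \<in> U" if "\<forall>j<Suc (idx g). y j = x j" for y
        proof -
          have "\<psi> y (idx g) = \<psi> x (idx g)" by (rule \<psi>_local) (use that in simp)
          then show ?thesis using U \<open>g \<in> carrier K\<close> by (simp add: char_code code_\<Psi>)
        qed
        then have "\<forall>y. (\<forall>j<Suc (idx g). y j = x j) \<longrightarrow> positive_cone_char K (\<Psi> y) g \<in> U" by blast
        then show "\<exists>n. \<forall>y. (\<forall>j<n. y j = x j) \<longrightarrow> positive_cone_char K (\<Psi> y) g \<in> U" by blast
      qed auto
      then show "continuous_map cantor_space
          (product_topology (\<lambda>_. discrete_topology UNIV) (carrier K)) (positive_cone_char K \<circ> \<Psi>)"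
        by (auto simp: continuous_map_componentwise positive_cone_char_def)
    qed
    have "continuous_map (LO_space K) (product_topology (\<lambda>_. discrete_topology (UNIV :: bool set)) (carrier K))
        (id \<circ> positive_cone_char K)"
      unfolding LO_space_def by (rule continuous_map_pullback) auto
    then show "Hausdorff_space (LO_space K)"
      using inj_on_positive_cone_char[OF K]
      by (intro Hausdorff_space_injective_preimage[where f = "positive_cone_char K"])
        (auto simp: Hausdorff_space_product_topology topspace_LO_space)
  qed (use bij compact_cantor_space in \<open>auto simp: bij_betw_def topspace_LO_space LO_def\<close>)
  then have "LO_space K homeomorphic_space cantor_space"
    using homeomorphic_map_imp_homeomorphic_space homeomorphic_space_sym by blast
  then show ?thesis
    by (rule homeomorphic_space_trans[OF _ cantor_space_homeomorphic_cantor_set])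
qed

theorem theorem2p1:
  fixes G :: "('a, 'c) monoid_scheme" and H :: "('b, 'd) monoid_scheme"
  assumes "group G" and "group H"
    and "carrier G \<noteq> {\<one>\<^bsub>G\<^esub>}" and "carrier H \<noteq> {\<one>\<^bsub>H\<^esub>}"
    and "finitely_generated G" and "finitely_generated H"
    and "left_orderable G" and "left_orderable H"
  shows "(\<forall>r. left_ordering (free_product G H) r \<longrightarrow>
            \<not> isolated_left_ordering (free_product G H) r) \<and>
         LO_space (free_product G H) homeomorphic_space top_of_set cantor_set"
proof -
  interpret free_product_groups G H using assms(1,2) by (simp add: free_product_groups_def)
  have count: "countable (carrier G)" "countable (carrier H)"
    using countable_finitely_generated assms by auto
  have no_isolated: "\<not> isolated_left_ordering (free_product G H) r" for r
    by (rule free_product_no_isolated_left_ordering[OF assms(3,4) count])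
  have "LO_space (free_product G H) homeomorphic_space top_of_set cantor_set"
  proof (rule LO_space_homeomorphic_cantor_set)
    show "countable (carrier (free_product G H))" using countable_reduced_words[OF count] by simp
  qed (use group_free_product left_orderable_free_product[OF assms(7,8) count] no_isolated in auto)
  then show ?thesis using no_isolated by blast
qed

end
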